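(* Let $G$ be an infinite virtually solvable group. Then the action of $G$ on $\mathrm{Sub}_\infty(G)$ by conjugation is topologically transitive if and only if $G\cong\mathbb Z$.
   Context: All groups are countable and discrete. $\mathrm{Sub}(G)$ is the set of subgroups of $G$ with the topology induced from the product topology on $2^G$, and $\mathrm{Sub}_\infty(G)=\{H\le G\mid |G:H|=\infty\}$ with the subspace topology; $G$ acts by $H\mapsto gHg^{-1}$. An action of $G$ on a topological space $X$ is topologically transitive if for all non-empty open $U,V\subseteq X$ there is $g\in G$ with $g(U)\cap V\ne\emptyset$. *)

theory Defs
  imports
    "HOL-Analysis.Analysis"
    "HOL-Algebra.Solvable_Groups"
    "HOL-Algebra.Elementary_Groups"
    "HOL-Algebra.Group_Action"
begin

definition subgroups :: "('a, 'b) monoid_scheme \<Rightarrow> 'a set set"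
  where "subgroups G = {H. subgroup H G}"

definition infinite_index_subgroups :: "('a, 'b) monoid_scheme \<Rightarrow> 'a set set"
  where "infinite_index_subgroups G = {H. subgroup H G \<and> infinite (rcosets\<^bsub>G\<^esub> H)}"

definition virtually_solvable :: "('a, 'b) monoid_scheme \<Rightarrow> bool"
  where "virtually_solvable G \<longleftrightarrow>
    (\<exists>H. subgroup H G \<and> finite (rcosets\<^bsub>G\<^esub> H) \<and> solvable (G\<lparr>carrier := H\<rparr>))"

text \<open>A subset of \<open>carrier G\<close> is identified with its indicator function, a point of the
  product of copies of the discrete two-point space \<open>bool\<close> indexed by \<open>carrier G\<close>. Points of
  \<^const>\<open>product_topology\<close> are extensional functions, hence the restriction.\<close>

definition subgroup_topology :: "('a, 'b) monoid_scheme \<Rightarrow> 'a set topology"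
  where "subgroup_topology G =
    pullback_topology (subgroups G) (\<lambda>H. \<lambda>x\<in>carrier G. x \<in> H)
      (product_topology (\<lambda>_. discrete_topology (UNIV :: bool set)) (carrier G))"

definition infinite_index_topology :: "('a, 'b) monoid_scheme \<Rightarrow> 'a set topology"
  where "infinite_index_topology G =
    subtopology (subgroup_topology G) (infinite_index_subgroups G)"

definition conjugation_action :: "('a, 'b) monoid_scheme \<Rightarrow> 'a \<Rightarrow> 'a set \<Rightarrow> 'a set"
  where "conjugation_action G =
    (\<lambda>g. \<lambda>H\<in>infinite_index_subgroups G. g <#\<^bsub>G\<^esub> H #>\<^bsub>G\<^esub> (inv\<^bsub>G\<^esub> g))"

definition topologically_transitive ::
    "('a, 'b) monoid_scheme \<Rightarrow> 'c topology \<Rightarrow> ('a \<Rightarrow> 'c \<Rightarrow> 'c) \<Rightarrow> bool"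
  where "topologically_transitive G X \<phi> \<longleftrightarrow>
    (\<forall>U V. openin X U \<and> U \<noteq> {} \<and> openin X V \<and> V \<noteq> {} \<longrightarrow>
      (\<exists>g\<in>carrier G. \<phi> g ` U \<inter> V \<noteq> {}))"

lemma topspace_subgroup_topology: "topspace (subgroup_topology G) = subgroups G"
  by (auto simp: subgroup_topology_def topspace_pullback_topology)

lemma topspace_infinite_index_topology:
  "topspace (infinite_index_topology G) = infinite_index_subgroups G"
  by (auto simp: infinite_index_topology_def topspace_subgroup_topology
      subgroups_def infinite_index_subgroups_def)

lemma (in group) conjugate_in_infinite_index_subgroups:
  assumes g: "g \<in> carrier G" and H: "H \<in> infinite_index_subgroups G"
  shows "g <# H #> (inv g) \<in> infinite_index_subgroups G"
proof -
  let ?K = "g <# H #> (inv g)"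
  have sH: "subgroup H G" and infH: "infinite (rcosets H)"
    using H by (auto simp: infinite_index_subgroups_def)
  have Hc: "H \<subseteq> carrier G" using sH by (rule subgroup.subset)
  have sK: "subgroup ?K G" using subgroup_conjugation_is_surj2[OF g sH] .
  have "rcosets H \<subseteq> (\<lambda>C. inv g <# (C #> g)) ` (rcosets ?K)"
  proof
    fix C assume "C \<in> rcosets H"
    then obtain y where y: "y \<in> carrier G" "C = H #> y"
      by (auto simp: RCOSETS_def)
    let ?x = "g \<otimes> y \<otimes> inv g"
    have x: "?x \<in> carrier G" using g y by simp
    have "inv g <# (?K #> ?x #> g) = inv g <# (g <# H #> (inv g \<otimes> ?x \<otimes> g))"
      using g y Hc x by (simp add: coset_mult_assoc l_coset_subset_G m_assoc)
    also have "inv g \<otimes> ?x \<otimes> g = y"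
      using g y by (simp add: m_assoc [symmetric]) (simp add: m_assoc)
    also have "inv g <# (g <# H #> y) = H #> y"
    proof -
      have "inv g <# (g <# H #> y) = inv g <# (g <# (H #> y))"
        using g y Hc by (simp add: coset_assoc)
      also have "\<dots> = (inv g \<otimes> g) <# (H #> y)"
        using g y Hc by (intro lcos_m_assoc) (simp_all add: r_coset_subset_G)
      also have "\<dots> = H #> y"
        using g y Hc by (simp add: lcos_mult_one r_coset_subset_G)
      finally show ?thesis .
    qed
    finally have "C = inv g <# (?K #> ?x #> g)" using y by simp
    moreover have "?K #> ?x \<in> rcosets ?K" using x by (auto simp: RCOSETS_def)
    ultimately show "C \<in> (\<lambda>C. inv g <# (C #> g)) ` (rcosets ?K)" by blast
  qed
  then have "infinite (rcosets ?K)"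
    using infH finite_surj by blast
  then show ?thesis using sK by (simp add: infinite_index_subgroups_def)
qed

lemma (in group) group_action_conjugation_action:
  "group_action G (infinite_index_subgroups G) (conjugation_action G)"
proof -
  let ?E = "infinite_index_subgroups G"
  let ?c = "\<lambda>g H. g <# H #> (inv g)"
  have sub: "H \<subseteq> carrier G" if "H \<in> ?E" for H
    using that subgroup.subset by (auto simp: infinite_index_subgroups_def)
  have comp: "?c (x \<otimes> y) H = ?c x (?c y H)"
    if "x \<in> carrier G" "y \<in> carrier G" "H \<in> ?E" for x y H
    using that sub[OF that(3)]
    by (simp add: inv_mult_group coset_assoc coset_mult_assoc lcos_m_assoc
        l_coset_subset_G r_coset_subset_G)
  have bij: "conjugation_action G g \<in> Bij ?E" if g: "g \<in> carrier G" for g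
  proof -
    have inj: "inj_on (?c g) ?E"
      using subgroup_conjugation_is_inj[OF g] sub by (meson inj_onI)
    have "H \<in> ?c g ` ?E" if H: "H \<in> ?E" for H
    proof
      show "?c (inv g) H \<in> ?E" using conjugate_in_infinite_index_subgroups[of "inv g" H] g H by simp
      show "H = ?c g (?c (inv g) H)"
        using subgroup_conjugation_is_surj0[OF g sub[OF H]] g by simp
    qed
    then have "?c g ` ?E = ?E"
      using conjugate_in_infinite_index_subgroups[OF g] by blast
    then show ?thesis
      using inj by (auto simp: Bij_def bij_betw_def conjugation_action_def inj_on_restrict_eq)
  qed
  have "conjugation_action G \<in> hom G (BijGroup ?E)"
  proof (rule homI)
    fix x assume "x \<in> carrier G"
    then show "conjugation_action G x \<in> carrier (BijGroup ?E)" by (simp add: BijGroup_def bij)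
  next
    fix x y assume xy: "x \<in> carrier G" "y \<in> carrier G"
    have "conjugation_action G (x \<otimes> y)
        = compose ?E (conjugation_action G x) (conjugation_action G y)"
      using xy comp conjugate_in_infinite_index_subgroups
      by (intro ext) (simp add: conjugation_action_def compose_def)
    then show "conjugation_action G (x \<otimes> y)
        = conjugation_action G x \<otimes>\<^bsub>BijGroup ?E\<^esub> conjugation_action G y"
      using xy by (simp add: BijGroup_def bij)
  qed
  then show ?thesis
    unfolding group_action_def group_hom_def
    by (simp add: group_BijGroup group_hom_axioms.intro)
qed

end

theory Submission
  imports Defs "HOL-Algebra.Zassenhaus"
begin

text \<open>If \<open>G\<close> is infinite cyclic, a nontrivial subgroup has finite index, so the space of subgroups of
  infinite index is a single point and every action on it is topologically transitive. Conversely,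
  let \<open>G\<close> act topologically transitively. There are two cases.
  
  Suppose first that no cyclic subgroup has finite index. Then, for each \<open>t\<close>, the subgroups of
  infinite index that contain a conjugate of \<open>t\<close> form an open set, which is nonempty and hence, by
  transitivity, dense. The subgroups of infinite index form a \<open>G\<^sub>\<delta>\<close> in a compact metrizable space,
  so the Baire category theorem yields one subgroup \<open>H\<close> of infinite index that meets every
  conjugacy class (\<open>transitive_imp_conjugate_dense\<close>). No virtually solvable group contains such an
  \<open>H\<close> (\<open>virtually_solvable_conjugate_dense\<close>): along the derived series of a normal solvable subgroup
  of finite index, with terms \<open>N\<close>, the index of \<open>H N\<close> stays finite. Indeed, when \<open>H N\<close> has
  finite index, finitely many conjugates of the subgroup \<open>H N'\<close>, where \<open>N'\<close> is the commutator
  subgroup of \<open>N\<close>, cover \<open>N\<close>, and by B. H. Neumann's theorem on coverings by cosets one of them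
  meets \<open>N\<close> in a subgroup of finite index of \<open>N\<close> (\<open>finitely_covers_mult_descend\<close>). At the
  end of the series \<open>H\<close> itself has finite index, a contradiction.
  
  Suppose now that some cyclic subgroup has finite index
  (\<open>transitive_virtually_cyclic\<close>). It may be replaced by a normal one, generated by \<open>z\<close>; let \<open>C\<close> be
  the centralizer of \<open>z\<close>. Every \<open>c\<close> in \<open>C\<close> has finitely many conjugates. If \<open>c\<close> is nontrivial and
  generates a subgroup of infinite index, then "contains \<open>c\<close>" and "contains no conjugate of \<open>c\<close>"
  are open conditions satisfied by subgroups of infinite index, and no conjugate of a subgroup
  satisfying the first satisfies the second, against transitivity. Hence \<open>C\<close> is torsion free,
  and the transfer into the central subgroup generated by \<open>z\<close> embeds \<open>C\<close> into the integers, so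
  \<open>C\<close> is generated by some \<open>d\<close>. If \<open>C\<close> is not all of \<open>G\<close>, then \<open>G\<close> is infinite dihedral, with
  non-conjugate reflections \<open>s\<close> and \<open>d s\<close>; a subgroup containing \<open>s\<close> and a conjugate of \<open>d s\<close> contains
  an odd power of \<open>d\<close> and so has finite index, against transitivity. Hence \<open>G = C\<close>.\<close>


section \<open>Finite index\<close>

text \<open>For subgroups \<open>H\<close> and \<open>K\<close> with \<open>H \<subseteq> K\<close> this says that \<open>H\<close> has finite index in \<open>K\<close>, but unlike the
  index it also makes sense for sets such as the products \<open>H N\<close>, it is transitive, and it passes
  from a subgroup to the ambient group.\<close>

definition finitely_covers :: "('a, 'b) monoid_scheme \<Rightarrow> 'a set \<Rightarrow> 'a set \<Rightarrow> bool"
  where "finitely_covers G H K \<longleftrightarrow> (\<exists>F. finite F \<and> F \<subseteq> carrier G \<and> K \<subseteq> H <#>\<^bsub>G\<^esub> F)"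

lemma finite_set_mult: "finite A \<Longrightarrow> finite B \<Longrightarrow> finite (A <#>\<^bsub>G\<^esub> B)"
  by (simp add: set_mult_def)

lemma set_mult_iff: "x \<in> A <#>\<^bsub>G\<^esub> B \<longleftrightarrow> (\<exists>a\<in>A. \<exists>b\<in>B. x = a \<otimes>\<^bsub>G\<^esub> b)"
  by (auto simp: set_mult_def)

context group
begin

lemma inv_mult_cancel [simp]:
  "\<lbrakk>x \<in> carrier G; y \<in> carrier G\<rbrakk> \<Longrightarrow> inv x \<otimes> (x \<otimes> y) = y"
  "\<lbrakk>x \<in> carrier G; y \<in> carrier G\<rbrakk> \<Longrightarrow> x \<otimes> (inv x \<otimes> y) = y"
  by (simp_all flip: m_assoc)

lemma finitely_covers_trans:
  assumes "finitely_covers G H K" "finitely_covers G K L" "H \<subseteq> carrier G"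
  shows "finitely_covers G H L"
proof -
  obtain E F where E: "finite E" "E \<subseteq> carrier G" "K \<subseteq> H <#> E"
    and F: "finite F" "F \<subseteq> carrier G" "L \<subseteq> K <#> F"
    using assms by (auto simp: finitely_covers_def)
  have "L \<subseteq> (H <#> E) <#> F"
    using F(3) mono_set_mult[OF E(3), of F F] by blast
  also have "\<dots> = H <#> (E <#> F)"
    using E F assms by (simp add: set_mult_assoc)
  finally show ?thesis
    unfolding finitely_covers_def
    using E F by (meson finite_set_mult setmult_subset_G)
qed

lemma finite_rcosets_iff:
  assumes H: "subgroup H G"
  shows "finite (rcosets H) \<longleftrightarrow> finitely_covers G H (carrier G)"
proof
  assume fin: "finite (rcosets H)"
  define F where "F = (\<lambda>C. SOME x. x \<in> C) ` (rcosets H)"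
  have rep: "(SOME x. x \<in> C) \<in> C" if "C \<in> rcosets H" for C
    using subgroup.rcosets_non_empty[OF H that] by (simp add: some_in_eq)
  have "F \<subseteq> carrier G"
    using rep rcosets_part_G[OF H] by (auto simp: F_def)
  moreover have "carrier G \<subseteq> H <#> F"
  proof
    fix x assume x: "x \<in> carrier G"
    define y where "y = (SOME y. y \<in> H #> x)"
    have C: "H #> x \<in> rcosets H"
      using rcosetsI subgroup.subset[OF H] x by blast
    have y: "y \<in> H #> x" using rep[OF C] by (simp add: y_def)
    then have "x \<in> H #> y"
      using repr_independence[OF y x H] rcos_self[OF x H] by metis
    moreover have "y \<in> F" using C by (auto simp: F_def y_def)
    ultimately show "x \<in> H <#> F" by (auto simp: set_mult_def r_coset_def)
  qed
  ultimately show "finitely_covers G H (carrier G)"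
    using fin by (auto simp: finitely_covers_def F_def)
next
  assume "finitely_covers G H (carrier G)"
  then obtain F where F: "finite F" "F \<subseteq> carrier G" "carrier G \<subseteq> H <#> F"
    by (auto simp: finitely_covers_def)
  have "rcosets H \<subseteq> (\<lambda>x. H #> x) ` F"
  proof
    fix C assume "C \<in> rcosets H"
    then obtain x where x: "x \<in> carrier G" "C = H #> x" by (auto simp: RCOSETS_def)
    then obtain y where y: "y \<in> F" "x \<in> H #> y"
      using F(3) by (force simp: set_mult_def r_coset_def)
    then have "H #> y = H #> x"
      using repr_independence[OF y(2) _ H] F(2) by blast
    then show "C \<in> (\<lambda>x. H #> x) ` F" using x y by blast
  qed
  then show "finite (rcosets H)" using F(1) finite_surj by blast
qed

text \<open>B. H. Neumann's theorem. If some subgroup \<open>L\<close> of the family leaves out a coset \<open>L y\<close>, this coset is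
  covered by translates of the other subgroups. All cosets of \<open>L\<close> are translates of \<open>L y\<close>, so \<open>L\<close> can
  be dropped from the family at the price of more translates. The induction is possible because the
  family is covering through cosets and not only through the subgroups themselves.\<close>

lemma neumann_covering:
  assumes "finite \<S>" "\<And>L. L \<in> \<S> \<Longrightarrow> subgroup L G"
    and "finite F" "F \<subseteq> carrier G" "carrier G \<subseteq> (\<Union>L\<in>\<S>. L <#> F)"
  shows "\<exists>L\<in>\<S>. finitely_covers G L (carrier G)"
  using assms
proof (induction \<S> arbitrary: F rule: finite_induct)
  case empty
  then show ?case using one_closed by auto
next
  case (insert L \<S>)
  show ?case
  proof (cases "carrier G \<subseteq> L <#> F")
    case True
    then show ?thesis using insert.prems by (auto simp: finitely_covers_def)
  next
    case False
    have L: "subgroup L G" and Lc: "L \<subseteq> carrier G"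
      using insert.prems(1) subgroup.subset by auto
    obtain y where y: "y \<in> carrier G" "y \<notin> L <#> F" using False by blast
    \<comment> \<open>A point \<open>a f\<close> of a translate \<open>L f\<close> is moved into the coset \<open>L y\<close> by \<open>f\<inverse> y\<close>; there it has the
      form \<open>b e\<close> with \<open>b\<close> in another subgroup, and moving it back gives \<open>b (e y\<inverse> f)\<close>.\<close>
    define F' where "F' = F \<union> (F <#> ({inv y} <#> F))"
    have "finite F'" "F' \<subseteq> carrier G"
      using insert.prems(2,3) y by (simp_all add: F'_def finite_set_mult setmult_subset_G)
    moreover have "carrier G \<subseteq> (\<Union>K\<in>\<S>. K <#> F')"
    proof
      fix g assume g: "g \<in> carrier G"
      then have "g \<in> (\<Union>K\<in>insert L \<S>. K <#> F)" using insert.prems(4) by blast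
      then obtain K a f where K: "K \<in> insert L \<S>" "a \<in> K" "f \<in> F" "g = a \<otimes> f"
        unfolding UN_iff set_mult_iff by blast
      show "g \<in> (\<Union>K\<in>\<S>. K <#> F')"
      proof (cases "K \<in> \<S>")
        case True
        then show ?thesis using K by (auto simp: set_mult_iff F'_def)
      next
        case False
        then have a: "a \<in> L" "a \<in> carrier G" and f: "f \<in> carrier G"
          using K Lc insert.prems(3) by auto
        have ay: "a \<otimes> y \<notin> L <#> F"
        proof
          assume "a \<otimes> y \<in> L <#> F"
          then obtain b e where b: "b \<in> L" "e \<in> F" "a \<otimes> y = b \<otimes> e" by (auto simp: set_mult_iff)
          have bc: "b \<in> carrier G" "e \<in> carrier G" using b Lc insert.prems(3) by auto
          have "y = inv a \<otimes> (a \<otimes> y)" using a y by simp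
          also have "\<dots> = (inv a \<otimes> b) \<otimes> e" using a b bc by (simp add: m_assoc)
          finally have "y = (inv a \<otimes> b) \<otimes> e" .
          then show False
            using y b a L by (auto simp: set_mult_iff subgroup.m_closed subgroup.m_inv_closed)
        qed
        have "a \<otimes> y \<in> (\<Union>K\<in>insert L \<S>. K <#> F)"
          using insert.prems(4) a y by blast
        then have "a \<otimes> y \<in> (\<Union>K\<in>\<S>. K <#> F)" using ay by blast
        then obtain M b e where M: "M \<in> \<S>" "b \<in> M" "e \<in> F" "a \<otimes> y = b \<otimes> e"
          unfolding UN_iff set_mult_iff by blast
        have bc: "b \<in> carrier G" "e \<in> carrier G"
          using M insert.prems(1,3) subgroup.subset by blast+
        have "g = (a \<otimes> y) \<otimes> (inv y \<otimes> f)"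
          using K a f y by (simp add: m_assoc)
        also have "\<dots> = b \<otimes> (e \<otimes> (inv y \<otimes> f))"
          using M bc y f by (simp add: m_assoc)
        finally have g: "g = b \<otimes> (e \<otimes> (inv y \<otimes> f))" .
        have "inv y \<otimes> f \<in> {inv y} <#> F" using K by (auto simp: set_mult_iff)
        then have "e \<otimes> (inv y \<otimes> f) \<in> F <#> ({inv y} <#> F)"
          by (subst set_mult_iff) (use M in blast)
        then have "e \<otimes> (inv y \<otimes> f) \<in> F'" by (simp add: F'_def)
        then have "g \<in> M <#> F'" using M g unfolding set_mult_iff by blast
        then show ?thesis using M by blast
      qed
    qed
    ultimately obtain K where "K \<in> \<S>" "finitely_covers G K (carrier G)"
      using insert.IH[of F'] insert.prems(1) by blast
    then show ?thesis by blast
  qed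
qed

section \<open>Subgroups that meet every conjugacy class\<close>

lemma inv_conjugate_conjugate:
  "x \<in> carrier G \<Longrightarrow> y \<in> carrier G \<Longrightarrow> inv x \<otimes> (x \<otimes> y \<otimes> inv x) \<otimes> x = y"
  by (simp add: m_assoc)

lemma conjugate_mult:
  "\<lbrakk>g \<in> carrier G; x \<in> carrier G; y \<in> carrier G\<rbrakk> \<Longrightarrow>
    g \<otimes> (x \<otimes> y) \<otimes> inv g = (g \<otimes> x \<otimes> inv g) \<otimes> (g \<otimes> y \<otimes> inv g)"
  by (simp add: m_assoc)

lemma conjugate_inv:
  "\<lbrakk>g \<in> carrier G; x \<in> carrier G\<rbrakk> \<Longrightarrow> g \<otimes> inv x \<otimes> inv g = inv (g \<otimes> x \<otimes> inv g)"
  by (simp add: m_assoc inv_mult_group)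

lemma subgroup_vimage_conjugation:
  assumes "subgroup L G" "subgroup N G" "c \<in> carrier G"
  shows "subgroup {x \<in> N. c \<otimes> x \<otimes> inv c \<in> L} (G\<lparr>carrier := N\<rparr>)"
proof -
  interpret N: group "G\<lparr>carrier := N\<rparr>" using assms(2) subgroup_imp_group by blast
  note cl = subgroup.mem_carrier[OF assms(2)]
  show ?thesis
  proof (rule N.subgroupI)
    show "{x \<in> N. c \<otimes> x \<otimes> inv c \<in> L} \<noteq> {}"
      using assms subgroup.one_closed[OF assms(1)] subgroup.one_closed[OF assms(2)] by force
  qed (use assms cl in \<open>auto simp: m_inv_consistent conjugate_mult conjugate_inv
        subgroup.m_closed subgroup.m_inv_closed\<close>)
qed

text \<open>One step down a series with abelian factors. Let \<open>L = H M\<close>. As \<open>N/M\<close> is abelian and \<open>H N\<close> has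
  finite index, the elements that conjugate \<open>t \<in> N\<close> into \<open>H\<close> can be corrected to a finite set \<open>F\<close> of
  representatives, if \<open>H\<close> is enlarged to \<open>L\<close>: conjugation by \<open>H\<close> preserves \<open>H\<close>, and conjugation by \<open>N\<close> acts
  trivially on \<open>N/M\<close>. So the sets \<open>N \<inter> c\<inverse> L c\<close> with \<open>c \<in> F\<close> cover \<open>N\<close>, and by Neumann's theorem one
  of them has finite index in \<open>N\<close>. Conjugating by \<open>c\<close>, which preserves \<open>N\<close>, gives finite index of
  \<open>L\<close> in \<open>H N\<close>.\<close>

lemma finitely_covers_mult_descend:
  assumes H: "subgroup H G" and N: "N \<lhd> G" and M: "M \<lhd> G"
    and comm: "\<And>x y. x \<in> N \<Longrightarrow> y \<in> N \<Longrightarrow> x \<otimes> y \<otimes> inv x \<otimes> inv y \<in> M"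
    and meets: "\<And>t. t \<in> N \<Longrightarrow> \<exists>x\<in>carrier G. x \<otimes> t \<otimes> inv x \<in> H"
    and cov: "finitely_covers G (H <#> N) (carrier G)"
  shows "finitely_covers G (H <#> M) (carrier G)"
proof -
  define L where "L = H <#> M"
  have sN: "subgroup N G" and sM: "subgroup M G"
    using N M normal_imp_subgroup by auto
  have Hc: "H \<subseteq> carrier G" and Nc: "N \<subseteq> carrier G" and Mc: "M \<subseteq> carrier G"
    using H sN sM subgroup.subset by auto
  have sL: "subgroup L G"
    unfolding L_def using mult_norm_subgroup[OF M H] commut_normal[OF H M] by simp
  have Lc: "L \<subseteq> carrier G" using sL subgroup.subset by blast
  obtain F where F: "finite F" "F \<subseteq> carrier G" "carrier G \<subseteq> (H <#> N) <#> F"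
    using cov by (auto simp: finitely_covers_def)
  interpret GN: group "G\<lparr>carrier := N\<rparr>" using sN subgroup_imp_group by blast
  define \<S> where "\<S> = (\<lambda>c. {x \<in> N. c \<otimes> x \<otimes> inv c \<in> L}) ` F"
  have "\<exists>c\<in>F. c \<otimes> t \<otimes> inv c \<in> L" if t: "t \<in> N" for t
  proof -
    obtain x where x: "x \<in> carrier G" "x \<otimes> t \<otimes> inv x \<in> H" using meets t by blast
    then obtain h n c where c: "h \<in> H" "n \<in> N" "c \<in> F" "x = (h \<otimes> n) \<otimes> c"
      using F(3) by (fastforce simp: set_mult_iff)
    have car: "h \<in> carrier G" "n \<in> carrier G" "c \<in> carrier G" "t \<in> carrier G"
      using c t Hc Nc F by auto
    define u where "u = c \<otimes> t \<otimes> inv c"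
    have uN: "u \<in> N" and uc: "u \<in> carrier G"
      using N t car by (auto simp: u_def normal_inv_iff)
    have eq: "x \<otimes> t \<otimes> inv x = h \<otimes> (n \<otimes> u \<otimes> inv n) \<otimes> inv h"
      using c car by (simp add: u_def inv_mult_group m_assoc)
    then have "inv h \<otimes> (x \<otimes> t \<otimes> inv x) \<otimes> h = n \<otimes> u \<otimes> inv n"
      using car uc by (simp add: inv_conjugate_conjugate)
    then have in_H: "n \<otimes> u \<otimes> inv n \<in> H"
      using x c H by (metis subgroup.m_closed subgroup.m_inv_closed)
    \<comment> \<open>the second factor is the inverse of a conjugate of a commutator of \<open>n\<close> and \<open>u\<close>\<close>
    have "u = (n \<otimes> u \<otimes> inv n) \<otimes> inv (inv u \<otimes> (n \<otimes> u \<otimes> inv n \<otimes> inv u) \<otimes> u)"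
      using car uc by (simp add: m_assoc inv_mult_group)
    moreover have "inv (inv u \<otimes> (n \<otimes> u \<otimes> inv n \<otimes> inv u) \<otimes> u) \<in> M"
      using comm[of n u] c uN uc M normal.inv_op_closed1[OF M] subgroup.m_inv_closed[OF sM] by metis
    ultimately have "u \<in> L" using in_H unfolding L_def set_mult_iff by blast
    then show ?thesis using c u_def by blast
  qed
  then have "carrier (G\<lparr>carrier := N\<rparr>) \<subseteq> (\<Union>K\<in>\<S>. K <#>\<^bsub>G\<lparr>carrier := N\<rparr>\<^esub> {\<one>})"
    using Nc by (fastforce simp: set_mult_iff \<S>_def)
  moreover have "finite \<S>" using F by (simp add: \<S>_def)
  moreover have "subgroup K (G\<lparr>carrier := N\<rparr>)" if "K \<in> \<S>" for K
    using that F subgroup_vimage_conjugation[OF sL sN] by (auto simp: \<S>_def)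
  ultimately have "\<exists>K\<in>\<S>. finitely_covers (G\<lparr>carrier := N\<rparr>) K (carrier (G\<lparr>carrier := N\<rparr>))"
    using subgroup.one_closed[OF sN] by (intro GN.neumann_covering[of \<S> "{\<one>}"]) auto
  then obtain c E where c: "c \<in> F" and E: "finite E" "E \<subseteq> N"
    "N \<subseteq> {x \<in> N. c \<otimes> x \<otimes> inv c \<in> L} <#> E"
    by (auto simp: \<S>_def finitely_covers_def)
  have cc: "c \<in> carrier G" using c F by blast
  define E' where "E' = (\<lambda>e. c \<otimes> e \<otimes> inv c) ` E"
  have E': "finite E'" "E' \<subseteq> carrier G"
    using E Nc cc by (auto simp: E'_def)
  have "H <#> N \<subseteq> L <#> E'"
  proof
    fix g assume "g \<in> H <#> N"
    then obtain h n where hn: "h \<in> H" "n \<in> N" "g = h \<otimes> n" by (auto simp: set_mult_iff)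
    have nc: "n \<in> carrier G" and hc: "h \<in> carrier G" using hn Nc Hc by auto
    have "inv c \<otimes> n \<otimes> c \<in> N" using normal.inv_op_closed1[OF N cc hn(2)] .
    then obtain a e where a: "a \<in> N" "c \<otimes> a \<otimes> inv c \<in> L" "e \<in> E" "inv c \<otimes> n \<otimes> c = a \<otimes> e"
      using E(3) by (fastforce simp: set_mult_iff)
    have ac: "a \<in> carrier G" "e \<in> carrier G" using a E Nc by auto
    have "n = c \<otimes> (inv c \<otimes> n \<otimes> c) \<otimes> inv c" using nc cc by (simp add: m_assoc)
    also have "\<dots> = (c \<otimes> a \<otimes> inv c) \<otimes> (c \<otimes> e \<otimes> inv c)"
      using a ac cc by (simp add: conjugate_mult)
    finally have "g = (h \<otimes> (c \<otimes> a \<otimes> inv c)) \<otimes> (c \<otimes> e \<otimes> inv c)"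
      using hn hc ac cc by (simp add: m_assoc)
    moreover have "h \<in> L"
      unfolding L_def set_mult_iff using hn subgroup.one_closed[OF sM] hc by (metis r_one)
    then have "h \<otimes> (c \<otimes> a \<otimes> inv c) \<in> L" using a sL by (simp add: subgroup.m_closed)
    moreover have "c \<otimes> e \<otimes> inv c \<in> E'" using a by (simp add: E'_def)
    ultimately show "g \<in> L <#> E'" unfolding set_mult_iff by blast
  qed
  then have "finitely_covers G L (H <#> N)"
    using E' by (auto simp: finitely_covers_def)
  then show ?thesis
    using finitely_covers_trans cov Lc L_def by blast
qed

text \<open>The kernel of the right multiplication action on the right cosets of \<open>S\<close>, which is the intersection
  of all conjugates of \<open>S\<close>; in this form finiteness of the index is the finiteness of the set of
  self-maps of the coset space.\<close>

definition normal_core :: "'a set \<Rightarrow> 'a set"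
  where "normal_core S = {x \<in> carrier G. \<forall>g\<in>carrier G. S #> (g \<otimes> x) = S #> g}"

lemma normal_core_subset:
  assumes "subgroup S G" shows "normal_core S \<subseteq> S"
proof
  fix x assume "x \<in> normal_core S"
  then have "S #> (\<one> \<otimes> x) = S #> \<one>" and x: "x \<in> carrier G"
    unfolding normal_core_def by blast+
  then show "x \<in> S" using assms rcos_self[OF x assms] subgroup.subset[OF assms] by simp
qed

lemma normal_core_normal:
  assumes S: "subgroup S G" shows "normal_core S \<lhd> G"
proof (rule normal_invI)
  have Sc: "S \<subseteq> carrier G" using S subgroup.subset by blast
  show "subgroup (normal_core S) G"
  proof (rule subgroupI)
    show "normal_core S \<noteq> {}" by (auto simp: normal_core_def intro!: exI[of _ \<one>])
    fix a assume a: "a \<in> normal_core S"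
    have "S #> (g \<otimes> inv a) = S #> g" if "g \<in> carrier G" for g
    proof -
      have "S #> ((g \<otimes> inv a) \<otimes> a) = S #> (g \<otimes> inv a)"
        using a that by (simp add: normal_core_def)
      then show ?thesis using a that by (simp add: normal_core_def m_assoc)
    qed
    then show "inv a \<in> normal_core S" using a by (simp add: normal_core_def)
    fix b assume b: "b \<in> normal_core S"
    have "S #> (g \<otimes> (a \<otimes> b)) = S #> g" if "g \<in> carrier G" for g
    proof -
      have "S #> ((g \<otimes> a) \<otimes> b) = S #> (g \<otimes> a)" using a b that by (simp add: normal_core_def)
      then show ?thesis using a b that by (simp add: normal_core_def m_assoc)
    qed
    then show "a \<otimes> b \<in> normal_core S" using a b by (simp add: normal_core_def)
  qed (auto simp: normal_core_def)
  fix x h assume x: "x \<in> carrier G" and h: "h \<in> normal_core S"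
  have "S #> (g \<otimes> (x \<otimes> h \<otimes> inv x)) = S #> g" if g: "g \<in> carrier G" for g
  proof -
    have hc: "h \<in> carrier G" using h by (simp add: normal_core_def)
    have "S #> (g \<otimes> (x \<otimes> h \<otimes> inv x)) = (S #> ((g \<otimes> x) \<otimes> h)) #> inv x"
      using x g hc Sc by (simp add: coset_mult_assoc m_assoc)
    also have "S #> ((g \<otimes> x) \<otimes> h) = S #> (g \<otimes> x)"
      using h x g by (simp add: normal_core_def)
    also have "(S #> (g \<otimes> x)) #> inv x = S #> g"
      using x g Sc by (simp add: coset_mult_assoc m_assoc)
    finally show ?thesis .
  qed
  then show "x \<otimes> h \<otimes> inv x \<in> normal_core S" using x h by (simp add: normal_core_def)
qed

text \<open>An element is determined modulo the kernel by the map it induces on the finite set of cosets, so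
  one representative for each induced map is enough.\<close>

lemma normal_core_finite_index:
  assumes S: "subgroup S G" and fin: "finite (rcosets S)"
  shows "finitely_covers G (normal_core S) (carrier G)"
proof -
  define \<rho> where "\<rho> = (\<lambda>x. \<lambda>C\<in>rcosets S. C #> x)"
  have Sc: "S \<subseteq> carrier G" using S subgroup.subset by blast
  define F where "F = inv_into (carrier G) \<rho> ` (\<rho> ` carrier G)"
  have "\<rho> ` carrier G \<subseteq> rcosets S \<rightarrow>\<^sub>E rcosets S"
  proof
    fix r assume "r \<in> \<rho> ` carrier G"
    then obtain x where x: "x \<in> carrier G" "r = \<rho> x" by blast
    have "C #> x \<in> rcosets S" if "C \<in> rcosets S" for C
      using that x Sc by (auto simp: RCOSETS_def coset_mult_assoc)
    then show "r \<in> rcosets S \<rightarrow>\<^sub>E rcosets S" using x by (simp add: \<rho>_def)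
  qed
  then have "finite (\<rho> ` carrier G)"
    using fin by (meson finite_PiE finite_subset)
  then have "finite F" by (simp add: F_def)
  moreover have Fc: "F \<subseteq> carrier G" by (auto simp: F_def inv_into_into)
  moreover have "carrier G \<subseteq> normal_core S <#> F"
  proof
    fix x assume x: "x \<in> carrier G"
    define y where "y = inv_into (carrier G) \<rho> (\<rho> x)"
    have yF: "y \<in> F" using x by (simp add: F_def y_def)
    then have y: "y \<in> carrier G" using Fc by blast
    have eq: "\<rho> y = \<rho> x" using x by (simp add: y_def f_inv_into_f)
    have "S #> (g \<otimes> (x \<otimes> inv y)) = S #> g" if g: "g \<in> carrier G" for g
    proof -
      have "(S #> g) #> x = (S #> g) #> y"
        using fun_cong[OF eq, of "S #> g"] rcosetsI[OF Sc g] by (simp add: \<rho>_def)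
      then have "((S #> g) #> x) #> inv y = ((S #> g) #> y) #> inv y" by simp
      then show ?thesis using x y g Sc by (simp add: coset_mult_assoc m_assoc)
    qed
    then have "x \<otimes> inv y \<in> normal_core S" using x y by (simp add: normal_core_def)
    moreover have "x = (x \<otimes> inv y) \<otimes> y" using x y by (simp add: m_assoc)
    ultimately show "x \<in> normal_core S <#> F" using yF by (auto simp: set_mult_iff)
  qed
  ultimately show ?thesis by (auto simp: finitely_covers_def)
qed

lemma derived_commutator:
  "x \<in> N \<Longrightarrow> y \<in> N \<Longrightarrow> x \<otimes> y \<otimes> inv x \<otimes> inv y \<in> derived G N"
  unfolding derived_def by (rule generate.incl) blast

lemma exp_of_derived_is_normal: "N \<lhd> G \<Longrightarrow> (derived G ^^ n) N \<lhd> G"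
  by (induction n) (auto intro: derived_is_normal)

lemma set_mult_one_right: "H \<subseteq> carrier G \<Longrightarrow> H <#> {\<one>} = H"
  by (simp add: r_coset_eq_set_mult[symmetric])

text \<open>The derived series of a solvable subgroup of finite index need not consist of normal subgroups
  of the whole group; that of its normal core does, since its terms are characteristic.\<close>

lemma virtually_solvable_normal_series:
  assumes "virtually_solvable G"
  shows "\<exists>N n. N \<lhd> G \<and> finitely_covers G N (carrier G) \<and> (derived G ^^ n) N = {\<one>}"
proof -
  obtain S where S: "subgroup S G" "finite (rcosets S)" "solvable (G\<lparr>carrier := S\<rparr>)"
    using assms by (auto simp: virtually_solvable_def)
  interpret S: group "G\<lparr>carrier := S\<rparr>" using S subgroup_imp_group by blast
  obtain n where "(derived (G\<lparr>carrier := S\<rparr>) ^^ n) S = {\<one>}"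
    using S(3) by (auto simp: S.solvable_iff_trivial_derived_seq)
  moreover have "(derived (G\<lparr>carrier := S\<rparr>) ^^ n) S = (derived G ^^ n) S \<and> (derived G ^^ n) S \<subseteq> S" for n
    by (induction n) (use S derived_consistent derived_incl in auto)
  ultimately have "(derived G ^^ n) S = {\<one>}" by simp
  then have "(derived G ^^ n) (normal_core S) \<subseteq> {\<one>}"
    using mono_exp_of_derived[OF normal_core_subset[OF S(1)], of n] by simp
  moreover have "\<one> \<in> (derived G ^^ n) (normal_core S)"
    using exp_of_derived_is_normal[OF normal_core_normal[OF S(1)], of n]
      normal_imp_subgroup subgroup.one_closed by blast
  ultimately show ?thesis
    using normal_core_normal[OF S(1)] normal_core_finite_index[OF S(1,2)] by blast
qed

text \<open>The virtually solvable counterpart of the fact that a finite group is never the union of the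
  conjugates of a proper subgroup: the index of \<open>H N\<close> stays finite as \<open>N\<close> runs down the derived
  series, and at the end \<open>N\<close> is trivial.\<close>

theorem virtually_solvable_conjugate_dense:
  assumes "virtually_solvable G" and H: "subgroup H G"
    and meets: "\<And>t. t \<in> carrier G \<Longrightarrow> \<exists>x\<in>carrier G. x \<otimes> t \<otimes> inv x \<in> H"
  shows "finite (rcosets H)"
proof -
  obtain N n where N: "N \<lhd> G" "finitely_covers G N (carrier G)" "(derived G ^^ n) N = {\<one>}"
    using virtually_solvable_normal_series assms(1) by blast
  have Hc: "H \<subseteq> carrier G" using H subgroup.subset by blast
  have "finitely_covers G (H <#> (derived G ^^ i) N) (carrier G)" for i
  proof (induction i)
    case 0
    have "N \<subseteq> H <#> N"
      using subgroup.one_closed[OF H] subgroup.subset[OF normal_imp_subgroup[OF N(1)]]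
      by (force simp: set_mult_iff)
    then have "N <#> F \<subseteq> (H <#> N) <#> F" for F by (rule mono_set_mult) simp
    then show ?case using N(2) unfolding finitely_covers_def funpow.simps id_apply by (meson subset_trans)
  next
    case (Suc i)
    let ?N = "(derived G ^^ i) N"
    have n: "?N \<lhd> G" using exp_of_derived_is_normal N by blast
    have "derived G ?N \<lhd> G" using n derived_is_normal by blast
    then have "finitely_covers G (H <#> derived G ?N) (carrier G)"
      using finitely_covers_mult_descend[OF H n] meets Suc derived_commutator
        subgroup.subset[OF normal_imp_subgroup[OF n]] by blast
    then show ?case by simp
  qed
  from this[of n] have "finitely_covers G H (carrier G)"
    using N(3) set_mult_one_right[OF Hc] by simp
  then show ?thesis using finite_rcosets_iff H by blast
qed

end

section \<open>Baire category in the space of subgroups of infinite index\<close>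

lemma closedin_coordinate:
  assumes "x \<in> I"
  shows "closedin (product_topology (\<lambda>_. discrete_topology (UNIV :: bool set)) I)
    {u \<in> topspace (product_topology (\<lambda>_. discrete_topology UNIV) I). P (u x)}"
proof -
  have "{u \<in> topspace (product_topology (\<lambda>_. discrete_topology (UNIV :: bool set)) I). P (u x)}
    = {u \<in> topspace (product_topology (\<lambda>_. discrete_topology UNIV) I). u x \<in> Collect P}" by simp
  then show ?thesis
    using closedin_continuous_map_preimage[OF continuous_map_product_projection[OF assms],
        of "\<lambda>_. discrete_topology (UNIV :: bool set)" "Collect P"] by simp
qed

lemma openin_subgroup_topology_mem:
  assumes "x \<in> carrier G"
  shows "openin (subgroup_topology G) {H \<in> subgroups G. x \<in> H \<longleftrightarrow> b}"
proof -
  let ?P = "product_topology (\<lambda>_. discrete_topology (UNIV :: bool set)) (carrier G)"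
  have "openin ?P {u \<in> topspace ?P. u x \<in> {b}}"
    using openin_continuous_map_preimage[OF continuous_map_product_projection[OF assms],
        of "\<lambda>_. discrete_topology (UNIV :: bool set)" "{b}"] by simp
  moreover have "{H \<in> subgroups G. x \<in> H \<longleftrightarrow> b} =
      (\<lambda>H. \<lambda>x\<in>carrier G. x \<in> H) -` {u \<in> topspace ?P. u x \<in> {b}} \<inter> subgroups G"
    using assms by auto
  ultimately show ?thesis
    unfolding subgroup_topology_def openin_pullback_topology by blast
qed

lemma openin_infinite_index_mem:
  assumes "x \<in> carrier G"
  shows "openin (infinite_index_topology G) {H \<in> infinite_index_subgroups G. x \<in> H}"
    and "openin (infinite_index_topology G) {H \<in> infinite_index_subgroups G. x \<notin> H}"
proof -
  have "{H \<in> infinite_index_subgroups G. x \<in> H \<longleftrightarrow> b} =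
      {H \<in> subgroups G. x \<in> H \<longleftrightarrow> b} \<inter> infinite_index_subgroups G" for b
    by (auto simp: infinite_index_subgroups_def subgroups_def)
  then have "openin (infinite_index_topology G) {H \<in> infinite_index_subgroups G. x \<in> H \<longleftrightarrow> b}" for b
    unfolding infinite_index_topology_def
    by (simp only: openin_subtopology_Int openin_subgroup_topology_mem[OF assms])
  from this[of True] this[of False]
  show "openin (infinite_index_topology G) {H \<in> infinite_index_subgroups G. x \<in> H}"
    and "openin (infinite_index_topology G) {H \<in> infinite_index_subgroups G. x \<notin> H}"
    by simp_all
qed

context group
begin

lemma subgroup_topology_homeomorphic:
  "subgroup_topology G homeomorphic_space
    subtopology (product_topology (\<lambda>_. discrete_topology (UNIV :: bool set)) (carrier G))
      ((\<lambda>H. \<lambda>x\<in>carrier G. x \<in> H) ` subgroups G)"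
proof -
  let ?P = "product_topology (\<lambda>_. discrete_topology (UNIV :: bool set)) (carrier G)"
  let ?i = "\<lambda>H. \<lambda>x\<in>carrier G. x \<in> H"
  let ?j = "\<lambda>u. {x \<in> carrier G. u x}"
  have ji: "?j (?i H) = H" if "H \<in> subgroups G" for H
    using that subgroup.subset by (auto simp: subgroups_def)
  have "continuous_map (subgroup_topology G) ?P (id \<circ> ?i)"
    unfolding subgroup_topology_def by (rule continuous_map_pullback) simp
  then have "continuous_map (subgroup_topology G) (subtopology ?P (?i ` subgroups G)) ?i"
    by (auto simp: continuous_map_in_subtopology topspace_subgroup_topology)
  moreover have "continuous_map (subtopology ?P (?i ` subgroups G)) (subgroup_topology G) ?j"
    unfolding subgroup_topology_def
  proof (rule continuous_map_pullback')
    have "continuous_map (subtopology ?P (?i ` subgroups G)) ?P id"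
      by (rule continuous_map_from_subtopology) simp
    then show "continuous_map (subtopology ?P (?i ` subgroups G)) ?P (?i \<circ> ?j)"
      by (rule continuous_map_eq) (auto simp: ji fun_eq_iff)
    show "topspace (subtopology ?P (?i ` subgroups G)) \<subseteq> ?j -` subgroups G"
      using ji by auto
  qed
  ultimately have "homeomorphic_maps (subgroup_topology G) (subtopology ?P (?i ` subgroups G)) ?i ?j"
    using ji by (auto simp: homeomorphic_maps_def topspace_subgroup_topology)
  then show ?thesis unfolding homeomorphic_space_def by blast
qed

text \<open>Each instance of a subgroup axiom involves only finitely many coordinates of the indicator function,
  so each cuts out a closed set.\<close>

lemma closedin_indicators_of_subgroups:
  "closedin (product_topology (\<lambda>_. discrete_topology (UNIV :: bool set)) (carrier G))
    ((\<lambda>H. \<lambda>x\<in>carrier G. x \<in> H) ` subgroups G)"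
proof -
  let ?P = "product_topology (\<lambda>_. discrete_topology (UNIV :: bool set)) (carrier G)"
  let ?A = "\<lambda>x b. {u \<in> topspace ?P. u x \<longleftrightarrow> b}"
  have cl: "closedin ?P (?A x b)" if "x \<in> carrier G" for x b
    using closedin_coordinate[OF that] .
  have "(\<lambda>H. \<lambda>x\<in>carrier G. x \<in> H) ` subgroups G = ?A \<one> True \<inter>
      (\<Inter>x\<in>carrier G. ?A x False \<union> ?A (inv x) True) \<inter>
      (\<Inter>x\<in>carrier G. \<Inter>y\<in>carrier G. ?A x False \<union> ?A y False \<union> ?A (x \<otimes> y) True)"
    (is "?L = ?R")
  proof
    show "?L \<subseteq> ?R"
      by (auto simp: subgroups_def subgroup.m_closed subgroup.m_inv_closed subgroup.one_closed)
    show "?R \<subseteq> ?L"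
    proof
      fix u assume u: "u \<in> ?R"
      have ext: "u \<in> extensional (carrier G)"
        using u by (auto simp: PiE_def)
      have "subgroup {x \<in> carrier G. u x} G"
        using u by (intro subgroupI) auto
      moreover have "u = (\<lambda>x\<in>carrier G. x \<in> {x \<in> carrier G. u x})"
        using ext by (auto simp: fun_eq_iff extensional_def)
      ultimately show "u \<in> ?L" unfolding subgroups_def by blast
    qed
  qed
  moreover have "closedin ?P ?R"
    using one_closed
    by (intro closedin_Int closedin_INT closedin_Un cl) auto
  ultimately show ?thesis by simp
qed

lemma completely_metrizable_subgroup_topology:
  assumes "countable (carrier G)"
  shows "completely_metrizable_space (subgroup_topology G)"
proof -
  have "countable {i \<in> carrier G. \<nexists>a. topspace (discrete_topology (UNIV::bool set)) \<subseteq> {a}}"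
    by (rule countable_subset[OF _ assms]) blast
  then have "completely_metrizable_space
      (product_topology (\<lambda>_. discrete_topology (UNIV :: bool set)) (carrier G))"
    by (simp add: completely_metrizable_space_product_topology completely_metrizable_space_discrete_topology)
  then show ?thesis
    using homeomorphic_completely_metrizable_space subgroup_topology_homeomorphic
      completely_metrizable_space_closedin closedin_indicators_of_subgroups by blast
qed

text \<open>Subgroups of infinite index form a \<open>G\<^sub>\<delta>\<close> set: infinite index means that for none of the countably
  many finite sets \<open>F\<close> the translates \<open>H y\<close> with \<open>y \<in> F\<close> cover the group, and for a fixed \<open>F\<close> an uncovered
  point \<open>x\<close> is recognized by the finitely many conditions \<open>x y\<inverse> \<notin> H\<close>.\<close>

lemma completely_metrizable_infinite_index_topology:
  assumes "countable (carrier G)"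
  shows "completely_metrizable_space (infinite_index_topology G)"
proof -
  define U where "U F = {H \<in> subgroups G. \<not> carrier G \<subseteq> H <#> F}" for F
  define \<F> where "\<F> = {F. finite F \<and> F \<subseteq> carrier G}"
  have "openin (subgroup_topology G) (U F)" if F: "F \<in> \<F>" for F
  proof -
    have "U F = (\<Union>x\<in>carrier G. subgroups G \<inter> (\<Inter>y\<in>F. {H \<in> subgroups G. x \<otimes> inv y \<in> H \<longleftrightarrow> False}))"
    proof -
      have "x \<in> H <#> F \<longleftrightarrow> (\<exists>y\<in>F. x \<otimes> inv y \<in> H)"
        if x: "x \<in> carrier G" and H: "H \<in> subgroups G" for x H
      proof
        have sH: "subgroup H G" using H by (simp add: subgroups_def)
        assume "x \<in> H <#> F"
        then obtain h y where h: "h \<in> H" "y \<in> F" "x = h \<otimes> y" unfolding set_mult_iff by blast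
        then have "x \<otimes> inv y = h"
          using F subgroup.mem_carrier[OF sH] by (auto simp: \<F>_def m_assoc)
        then show "\<exists>y\<in>F. x \<otimes> inv y \<in> H" using h by blast
      next
        assume "\<exists>y\<in>F. x \<otimes> inv y \<in> H"
        then obtain y where y: "y \<in> F" "x \<otimes> inv y \<in> H" by blast
        then have "x = (x \<otimes> inv y) \<otimes> y" using F x by (auto simp: \<F>_def m_assoc)
        then show "x \<in> H <#> F" unfolding set_mult_iff using y by blast
      qed
      then show ?thesis by (auto simp: U_def)
    qed
    moreover have "openin (subgroup_topology G)
        (subgroups G \<inter> (\<Inter>y\<in>F. {H \<in> subgroups G. x \<otimes> inv y \<in> H \<longleftrightarrow> False}))"
      if "x \<in> carrier G" for x
    proof (cases "F = {}")
      case True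
      then show ?thesis
        using openin_topspace[of "subgroup_topology G"] by (simp add: topspace_subgroup_topology)
    next
      case False
      then show ?thesis
        using F that
        by (intro openin_Int openin_INT2 openin_subgroup_topology_mem)
          (auto simp: \<F>_def openin_topspace simp flip: topspace_subgroup_topology)
    qed
    ultimately show ?thesis by (simp only:) (rule openin_clauses(3), blast)
  qed
  moreover have "countable \<F>"
    unfolding \<F>_def using countable_Collect_finite_subset[OF assms] by (simp add: conj_commute)
  moreover have "infinite_index_subgroups G = \<Inter>(U ` \<F>)"
  proof -
    have "infinite_index_subgroups G = {H \<in> subgroups G. \<forall>F\<in>\<F>. \<not> carrier G \<subseteq> H <#> F}"
      by (auto simp: infinite_index_subgroups_def subgroups_def finite_rcosets_iff
          finitely_covers_def \<F>_def)
    moreover have "{} \<in> \<F>" by (simp add: \<F>_def)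
    ultimately show ?thesis by (auto simp: U_def)
  qed
  ultimately have "(countable intersection_of openin (subgroup_topology G)) (infinite_index_subgroups G)"
    unfolding intersection_of_def by (intro exI[of _ "U ` \<F>"]) auto
  then show ?thesis
    unfolding infinite_index_topology_def
    using completely_metrizable_space_gdelta_in_alt completely_metrizable_subgroup_topology assms by blast
qed

lemma transitive_obtain:
  assumes tt: "topologically_transitive G (infinite_index_topology G) (conjugation_action G)"
    and "openin (infinite_index_topology G) U" "openin (infinite_index_topology G) V"
    and "U \<noteq> {}" "V \<noteq> {}"
  obtains g H where "g \<in> carrier G" "H \<in> U" "g <# H #> inv g \<in> V"
proof -
  have "U \<subseteq> infinite_index_subgroups G"
    using openin_subset[OF assms(2)] by (simp add: topspace_infinite_index_topology)
  moreover obtain g where "g \<in> carrier G" "conjugation_action G g ` U \<inter> V \<noteq> {}"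
    using tt[unfolded topologically_transitive_def, rule_format, of U V] assms(2-5) by blast
  ultimately show ?thesis using that by (force simp: conjugation_action_def)
qed

lemma conjugate_mem_iff:
  assumes "g \<in> carrier G" "H \<subseteq> carrier G" "x \<in> carrier G"
  shows "x \<in> g <# H #> inv g \<longleftrightarrow> inv g \<otimes> x \<otimes> g \<in> H"
proof
  assume "x \<in> g <# H #> inv g"
  then obtain h where h: "h \<in> H" "x = g \<otimes> h \<otimes> inv g"
    by (auto simp: l_coset_def r_coset_def)
  then have "h \<in> carrier G" using assms by blast
  then show "inv g \<otimes> x \<otimes> g \<in> H" using h assms by (simp add: m_assoc)
next
  assume h: "inv g \<otimes> x \<otimes> g \<in> H"
  have "x = g \<otimes> (inv g \<otimes> x \<otimes> g) \<otimes> inv g" using assms by (simp add: m_assoc)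
  then show "x \<in> g <# H #> inv g" using h unfolding l_coset_def r_coset_def by blast
qed

text \<open>For each \<open>t\<close> the subgroups that contain a conjugate of \<open>t\<close> form an open set, the saturation of a
  nonempty open set under the action, which is dense by transitivity. A point common to all these
  sets exists by Baire category.\<close>

theorem transitive_imp_conjugate_dense:
  assumes tt: "topologically_transitive G (infinite_index_topology G) (conjugation_action G)"
    and countable: "countable (carrier G)"
    and cyc: "\<And>t. t \<in> carrier G \<Longrightarrow>
      \<exists>K\<in>infinite_index_subgroups G. t \<in> K"
  shows "\<exists>H\<in>infinite_index_subgroups G. \<forall>t\<in>carrier G. \<exists>x\<in>carrier G. x \<otimes> t \<otimes> inv x \<in> H"
proof -
  let ?X = "infinite_index_topology G"
  let ?E = "infinite_index_subgroups G"
  have sub: "H \<subseteq> carrier G" if "H \<in> ?E" for H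
    using that subgroup.subset by (auto simp: infinite_index_subgroups_def)
  define D where "D t = (\<Union>x\<in>carrier G. {H \<in> ?E. x \<otimes> t \<otimes> inv x \<in> H})" for t
  have "openin ?X (D t) \<and> ?X closure_of (D t) = topspace ?X" if t: "t \<in> carrier G" for t
  proof
    show "openin ?X (D t)"
      unfolding D_def using t by (auto intro!: openin_clauses(3) openin_infinite_index_mem)
    have "D t \<inter> W \<noteq> {}" if W: "openin ?X W" "W \<noteq> {}" for W
    proof -
      obtain g H where g: "g \<in> carrier G" "H \<in> {H \<in> ?E. t \<in> H}" "g <# H #> inv g \<in> W"
        using transitive_obtain[OF tt openin_infinite_index_mem(1)[OF t] W(1)] cyc[OF t] W(2) by blast
      have "g \<otimes> t \<otimes> inv g \<in> g <# H #> inv g"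
        using g by (auto simp: l_coset_def r_coset_def)
      moreover have "g <# H #> inv g \<in> ?E"
        using conjugate_in_infinite_index_subgroups g by blast
      ultimately show ?thesis using g by (auto simp: D_def)
    qed
    then show "?X closure_of (D t) = topspace ?X"
      unfolding dense_intersects_open by blast
  qed
  then have "?X closure_of \<Inter>(D ` carrier G) = topspace ?X"
    using completely_metrizable_infinite_index_topology[OF countable] countable
    by (intro Baire_category) auto
  moreover have "topspace ?X \<noteq> {}"
    using cyc[of \<one>] unfolding topspace_infinite_index_topology by auto
  ultimately have "\<Inter>(D ` carrier G) \<noteq> {}" by (metis closure_of_empty)
  then obtain H where H: "H \<in> D t" if "t \<in> carrier G" for t by blast
  then have "H \<in> ?E" using H[of \<one>] by (auto simp: D_def)
  moreover have "\<exists>x\<in>carrier G. x \<otimes> t \<otimes> inv x \<in> H" if "t \<in> carrier G" for t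
    using H[OF that] by (auto simp: D_def)
  ultimately show ?thesis by blast
qed

end

section \<open>Cyclic groups and the transfer\<close>

lemma int_subgroup_principal:
  fixes I :: "int set"
  assumes "I \<noteq> {}" and diff: "\<And>a b. a \<in> I \<Longrightarrow> b \<in> I \<Longrightarrow> a - b \<in> I"
  shows "\<exists>d. I = range (\<lambda>k. k * d)"
proof (cases "I = {0}")
  case True
  then show ?thesis by (intro exI[of _ 0]) auto
next
  case False
  have zero: "0 \<in> I" using assms diff by fastforce
  have neg: "- a \<in> I" if "a \<in> I" for a using diff[OF zero that] by simp
  have add: "a + b \<in> I" if "a \<in> I" "b \<in> I" for a b using diff[OF that(1) neg[OF that(2)]] by simp
  obtain a where "a \<in> I" "a \<noteq> 0" using False zero by blast
  then have "\<exists>n::nat. n > 0 \<and> int n \<in> I"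
    using neg[of a] by (intro exI[of _ "nat \<bar>a\<bar>"]) (auto simp: abs_if)
  then obtain n :: nat where n: "n > 0" "int n \<in> I" "\<And>m. m < n \<Longrightarrow> \<not> (m > 0 \<and> int m \<in> I)"
    using exists_least_iff[of "\<lambda>n. n > 0 \<and> int n \<in> I"] by auto
  have "int k * int n \<in> I" for k
    by (induction k) (auto simp: zero algebra_simps intro: add n)
  then have mult: "k * int n \<in> I" for k
    using neg[of "int (nat (- k)) * int n"] by (cases "k \<ge> 0") (metis nat_0_le, fastforce)
  have "a \<in> range (\<lambda>k. k * int n)" if "a \<in> I" for a
  proof -
    have "a mod int n \<in> I"
      using diff[OF that mult, of "a div int n"] by (simp only: minus_div_mult_eq_mod)
    then have "int (nat (a mod int n)) \<in> I" using n by simp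
    moreover have "nat (a mod int n) < n" using n by (simp add: nat_less_iff)
    ultimately have "a mod int n = 0" using n(3)[of "nat (a mod int n)"] n(1)
      by (smt (verit) pos_mod_sign of_nat_0_less_iff nat_0_iff gr0I)
    then have "a = (a div int n) * int n" by (metis add_0_right div_mult_mod_eq)
    then show ?thesis by blast
  qed
  then show ?thesis using mult by (intro exI[of _ "int n"]) auto
qed

context group
begin

definition powers :: "'a \<Rightarrow> 'a set"
  where "powers x = range (\<lambda>n::int. x [^] n)"

lemma powers_subgroup: "x \<in> carrier G \<Longrightarrow> subgroup (powers x) G"
  unfolding powers_def by (rule subgroup_of_powers)

lemma powers_self: "x \<in> carrier G \<Longrightarrow> x \<in> powers x"
  unfolding powers_def by (rule range_eqI[of _ _ 1]) (simp add: int_pow_1)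

lemma powers_subset_subgroup: "subgroup H G \<Longrightarrow> x \<in> H \<Longrightarrow> powers x \<subseteq> H"
  unfolding powers_def using subgroup_int_pow_closed by blast

lemma int_pow_conjugate:
  assumes "g \<in> carrier G" "x \<in> carrier G"
  shows "g \<otimes> x [^] (n::int) \<otimes> inv g = (g \<otimes> x \<otimes> inv g) [^] n"
proof -
  have "(\<lambda>x. g \<otimes> x \<otimes> inv g) \<in> hom G G"
    using assms(1) by (simp add: hom_def conjugate_mult)
  then show ?thesis using hom_int_pow[OF _ assms(2) is_group is_group] by metis
qed

lemma finite_powers:
  assumes x: "x \<in> carrier G" and k: "x [^] k = \<one>" "k \<noteq> (0::int)"
  shows "finite (powers x)"
proof -
  have "x [^] n \<in> (\<lambda>n. x [^] n) ` {- \<bar>k\<bar>..\<bar>k\<bar>}" for n :: int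
  proof (rule image_eqI)
    have "x [^] n = x [^] (k * (n div k) + n mod k)" by simp
    also have "\<dots> = x [^] (n mod k)"
      using x k by (simp only: int_pow_mult int_pow_pow[symmetric] int_pow_one l_one int_pow_closed)
    finally show "x [^] n = x [^] (n mod k)" .
    show "n mod k \<in> {- \<bar>k\<bar>..\<bar>k\<bar>}"
      using abs_mod_less[OF k(2), of n] by (auto simp: abs_le_iff)
  qed
  then have "powers x \<subseteq> (\<lambda>n. x [^] n) ` {- \<bar>k\<bar>..\<bar>k\<bar>}" unfolding powers_def by blast
  then show ?thesis using finite_surj by blast
qed

lemma int_pow_inject:
  assumes "infinite (powers x)" "x \<in> carrier G" "x [^] m = x [^] (n::int)"
  shows "m = n"
proof (rule ccontr)
  assume "m \<noteq> n"
  moreover have "x [^] (m - n) = \<one>" using assms by (simp add: int_pow_diff)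
  ultimately show False using finite_powers[of x "m - n"] assms by simp
qed

text \<open>Subgroups of cyclic groups are cyclic. The exponents that occur form a subgroup of the integers.\<close>

lemma subgroup_of_powers_principal:
  assumes M: "subgroup M G" and f: "f \<in> carrier G" and sub: "M \<subseteq> powers f"
  shows "\<exists>z\<in>M. M = powers z"
proof -
  define I where "I = {n::int. f [^] n \<in> M}"
  have "0 \<in> I" using subgroup.one_closed[OF M] by (simp add: I_def)
  moreover have "a - b \<in> I" if "a \<in> I" "b \<in> I" for a b
    using that f M by (simp add: I_def int_pow_diff subgroup.m_closed subgroup.m_inv_closed)
  ultimately obtain d where d: "I = range (\<lambda>k. k * d)"
    using int_subgroup_principal[of I] by blast
  have "f [^] d \<in> M" using d by (force simp: I_def)
  moreover have "M \<subseteq> powers (f [^] d)"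
  proof
    fix x assume x: "x \<in> M"
    then obtain n :: int where n: "x = f [^] n" using sub unfolding powers_def by blast
    then have "n \<in> I" using x by (simp add: I_def)
    then obtain k where "n = k * d" using d by blast
    then have "x = (f [^] d) [^] k" using n f by (simp add: int_pow_pow mult.commute)
    then show "x \<in> powers (f [^] d)" by (auto simp: powers_def)
  qed
  ultimately show ?thesis using powers_subset_subgroup[OF M] by blast
qed

lemma cyclic_if_embeds_in_integers:
  assumes "h \<in> hom G integer_group" "inj_on h (carrier G)"
  shows "\<exists>d\<in>carrier G. carrier G = powers d"
proof -
  interpret h: group_hom G integer_group h
    using assms by (simp add: group_hom_def group_hom_axioms_def)
  have "a - b \<in> h ` carrier G" if ab: "a \<in> h ` carrier G" "b \<in> h ` carrier G" for a b
  proof -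
    obtain x y where "x \<in> carrier G" "y \<in> carrier G" "a = h x" "b = h y" using ab by blast
    then have "a - b = h (x \<otimes> inv y)" "x \<otimes> inv y \<in> carrier G" by simp_all
    then show ?thesis by blast
  qed
  then obtain n where n: "h ` carrier G = range (\<lambda>k. k * n)"
    using int_subgroup_principal[of "h ` carrier G"] one_closed by blast
  have "n \<in> h ` carrier G" unfolding n by (rule range_eqI[of _ _ 1]) simp
  then obtain d where d: "d \<in> carrier G" "h d = n" by blast
  have "x \<in> powers d" if x: "x \<in> carrier G" for x
  proof -
    obtain k where "h x = k * n" using n x by blast
    then have "h x = h (d [^] k)" using d by (simp add: h.hom_int_pow)
    then have "x = d [^] k" using assms(2) x d by (simp add: inj_onD)
    then show ?thesis by (auto simp: powers_def)
  qed
  then show ?thesis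
    using d(1) powers_subset_subgroup[OF subgroup_self d(1)] by blast
qed

text \<open>Pigeonhole principle: two different powers of \<open>x\<close> lie in the same coset.\<close>

lemma power_mem_finite_index:
  assumes S: "subgroup S G" "finite (rcosets S)" and x: "x \<in> carrier G"
  shows "\<exists>m::int. m \<noteq> 0 \<and> x [^] m \<in> S"
proof -
  have Sc: "S \<subseteq> carrier G" using S subgroup.subset by blast
  have "\<not> inj_on (\<lambda>n::int. S #> x [^] n) UNIV"
  proof
    assume inj: "inj_on (\<lambda>n::int. S #> x [^] n) UNIV"
    have "range (\<lambda>n::int. S #> x [^] n) \<subseteq> rcosets S" using Sc x rcosetsI by auto
    then have "finite (UNIV :: int set)" using inj S finite_subset finite_imageD by blast
    then show False using infinite_UNIV_int by blast
  qed
  then obtain m n :: int where mn: "m \<noteq> n" "S #> x [^] m = S #> x [^] n"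
    by (auto simp: inj_on_def)
  then have "x [^] m \<in> S #> x [^] n" using rcos_self S x by (metis int_pow_closed)
  then have "x [^] m \<otimes> inv (x [^] n) \<in> S"
    using subgroup.rcos_module_imp[OF S(1) is_group] x by simp
  then show ?thesis using mn x by (intro exI[of _ "m - n"]) (simp add: int_pow_diff)
qed

text \<open>A torsion-free group with a central infinite cyclic subgroup \<open>Z\<close> of finite index is cyclic.
  Let \<open>\<epsilon> x\<close> be the exponent of the \<open>Z\<close>-part of \<open>x\<close> relative to fixed coset representatives. Because \<open>Z\<close>
  is central, the difference \<open>\<epsilon> (x t) - \<epsilon> t\<close> depends only on the coset of \<open>t\<close>, and its sum over all
  cosets, the transfer, is additive in \<open>x\<close>: for a product \<open>x y\<close> the sum telescopes after permuting
  the cosets by \<open>y\<close>. The transfer of \<open>z\<close> is the index of \<open>Z\<close>, hence not zero. Every element has a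
  nonzero power in \<open>Z\<close>, so elements of the kernel are torsion, hence trivial, and the group embeds
  into the integers.\<close>

lemma transfer_cyclic:
  assumes z: "z \<in> carrier G" and central: "\<And>x. x \<in> carrier G \<Longrightarrow> x \<otimes> z = z \<otimes> x"
    and fin: "finite (rcosets (powers z))"
    and torsion_free: "\<And>x. x \<in> carrier G \<Longrightarrow> x \<noteq> \<one> \<Longrightarrow> infinite (powers x)"
    and z1: "z \<noteq> \<one>"
  shows "\<exists>d\<in>carrier G. carrier G = powers d"
proof -
  define Z where "Z = powers z"
  have sZ: "subgroup Z G" using powers_subgroup z by (simp add: Z_def)
  have Zc: "Z \<subseteq> carrier G" using sZ subgroup.subset by blast
  have infZ: "infinite (powers z)" using torsion_free z z1 by blast
  have comm: "x \<otimes> z [^] k = z [^] k \<otimes> x" if "x \<in> carrier G" for x and k :: int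
  proof -
    have "x \<otimes> z \<otimes> inv x = z" using central[OF that] that z by (simp add: m_assoc)
    then have "x \<otimes> z [^] k \<otimes> inv x = z [^] k" using int_pow_conjugate[OF that z] by simp
    then show ?thesis using that z by (metis inv_solve_right' int_pow_closed m_closed)
  qed
  define r where "r C = (SOME x. x \<in> C)" for C :: "'a set"
  have r: "r C \<in> C" if "C \<in> rcosets Z" for C
    using subgroup.rcosets_non_empty[OF sZ that] by (simp add: some_in_eq r_def)
  have rc: "r C \<in> carrier G" if "C \<in> rcosets Z" for C
    using r[OF that] rcosets_part_G[OF sZ] that by blast
  have coset: "Z #> x \<in> rcosets Z" if "x \<in> carrier G" for x using rcosetsI Zc that by blast
  have r_coset: "Z #> r C = C" if C: "C \<in> rcosets Z" for C
  proof -
    obtain x where "x \<in> carrier G" "C = Z #> x" using C by (auto simp: RCOSETS_def)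
    then show ?thesis using repr_independence[of "r C" Z x] sZ r[OF C] by simp
  qed
  have coset_pow: "Z #> (z [^] k \<otimes> x) = Z #> x" if "x \<in> carrier G" for x and k :: int
    using that sZ z by (intro repr_independence[symmetric]) (auto simp: Z_def powers_def r_coset_def)
  have decomp: "\<exists>k::int. x = z [^] k \<otimes> r (Z #> x)" if x: "x \<in> carrier G" for x
  proof -
    have "x \<in> Z #> r (Z #> x)" using r_coset[OF coset[OF x]] rcos_self[OF x sZ] by simp
    then show ?thesis by (auto simp: Z_def powers_def r_coset_def)
  qed
  define \<epsilon> where "\<epsilon> x = (SOME k::int. x = z [^] k \<otimes> r (Z #> x))" for x
  have \<epsilon>: "x = z [^] \<epsilon> x \<otimes> r (Z #> x)" if "x \<in> carrier G" for x
    unfolding \<epsilon>_def using someI_ex[OF decomp[OF that]] .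
  have \<epsilon>_pow: "\<epsilon> (z [^] k \<otimes> x) = k + \<epsilon> x" if x: "x \<in> carrier G" for x k
  proof -
    have rx: "r (Z #> x) \<in> carrier G" using rc coset x by blast
    have "z [^] \<epsilon> (z [^] k \<otimes> x) \<otimes> r (Z #> x) = z [^] k \<otimes> x"
      using \<epsilon>[of "z [^] k \<otimes> x"] coset_pow x z by simp
    also have "\<dots> = z [^] k \<otimes> (z [^] \<epsilon> x \<otimes> r (Z #> x))" using \<epsilon>[OF x] by simp
    also have "\<dots> = z [^] (k + \<epsilon> x) \<otimes> r (Z #> x)" using rx z by (simp add: int_pow_mult m_assoc)
    finally have "z [^] \<epsilon> (z [^] k \<otimes> x) = z [^] (k + \<epsilon> x)" using rx z by simp
    then show ?thesis using int_pow_inject[OF infZ z] by blast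
  qed
  define \<phi> where "\<phi> x = (\<Sum>C\<in>rcosets Z. \<epsilon> (x \<otimes> r C) - \<epsilon> (r C))" for x
  have finZ: "finite (rcosets Z)" using fin by (simp add: Z_def)
  have hom: "\<phi> (x \<otimes> y) = \<phi> x + \<phi> y" if x: "x \<in> carrier G" and y: "y \<in> carrier G" for x y
  proof -
    define \<pi> where "\<pi> C = Z #> (y \<otimes> r C)" for C
    have maps: "\<pi> ` (rcosets Z) \<subseteq> rcosets Z" using coset rc y by (auto simp: \<pi>_def)
    have "inj_on \<pi> (rcosets Z)"
    proof (rule inj_onI)
      fix C D assume CD: "C \<in> rcosets Z" "D \<in> rcosets Z" "\<pi> C = \<pi> D"
      have cc: "r C \<in> carrier G" "r D \<in> carrier G" using rc CD by blast+
      have "y \<otimes> r C \<in> Z #> (y \<otimes> r D)"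
        using CD rcos_self[OF _ sZ, of "y \<otimes> r C"] y cc by (simp add: \<pi>_def)
      then obtain k :: int where "y \<otimes> r C = z [^] k \<otimes> (y \<otimes> r D)"
        by (auto simp: Z_def powers_def r_coset_def)
      also have "\<dots> = (z [^] k \<otimes> y) \<otimes> r D" using y z cc by (simp add: m_assoc)
      also have "\<dots> = y \<otimes> (z [^] k \<otimes> r D)" using y z cc comm[OF y] by (simp add: m_assoc flip: comm[OF y])
      finally have "r C = z [^] k \<otimes> r D" using y z cc by simp
      then show "C = D" using coset_pow[OF cc(2)] r_coset CD by metis
    qed
    then have bij: "bij_betw \<pi> (rcosets Z) (rcosets Z)"
      using maps finZ endo_inj_surj by (simp add: bij_betw_def)
    have shift: "\<epsilon> (x \<otimes> (y \<otimes> r C)) - \<epsilon> (y \<otimes> r C) = \<epsilon> (x \<otimes> r (\<pi> C)) - \<epsilon> (r (\<pi> C))"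
      if C: "C \<in> rcosets Z" for C
    proof -
      have cc: "y \<otimes> r C \<in> carrier G" "r (\<pi> C) \<in> carrier G" using rc C y maps by auto
      obtain k :: int where k: "y \<otimes> r C = z [^] k \<otimes> r (\<pi> C)" using decomp[OF cc(1)] by (auto simp: \<pi>_def)
      have "x \<otimes> (z [^] k \<otimes> r (\<pi> C)) = z [^] k \<otimes> (x \<otimes> r (\<pi> C))"
        using x z cc comm[OF x, of k] by (simp flip: m_assoc)
      then show ?thesis using k \<epsilon>_pow x cc by simp
    qed
    have "\<phi> (x \<otimes> y) = (\<Sum>C\<in>rcosets Z. (\<epsilon> (x \<otimes> (y \<otimes> r C)) - \<epsilon> (y \<otimes> r C)) + (\<epsilon> (y \<otimes> r C) - \<epsilon> (r C)))"
      unfolding \<phi>_def using x y rc by (intro sum.cong) (auto simp: m_assoc)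
    also have "\<dots> = (\<Sum>C\<in>rcosets Z. \<epsilon> (x \<otimes> r (\<pi> C)) - \<epsilon> (r (\<pi> C))) + \<phi> y"
      by (simp add: sum.distrib \<phi>_def shift)
    also have "(\<Sum>C\<in>rcosets Z. \<epsilon> (x \<otimes> r (\<pi> C)) - \<epsilon> (r (\<pi> C))) = \<phi> x"
      unfolding \<phi>_def using sum.reindex_bij_betw[OF bij] .
    finally show ?thesis .
  qed
  then have h: "\<phi> \<in> hom G integer_group" by (auto simp: hom_def)
  interpret \<phi>: group_hom G integer_group \<phi>
    using h by (simp add: group_hom_def group_hom_axioms_def)
  have "\<phi> z = int (card (rcosets Z))"
    using \<epsilon>_pow[of _ 1] z rc by (simp add: \<phi>_def int_pow_1)
  moreover have "rcosets Z \<noteq> {}" using coset one_closed by blast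
  ultimately have \<phi>z: "\<phi> z \<noteq> 0" using finZ by simp
  have "x = \<one>" if x: "x \<in> carrier G" "\<phi> x = 0" for x
  proof (rule ccontr)
    assume "x \<noteq> \<one>"
    then have infx: "infinite (powers x)" using torsion_free x by blast
    obtain m :: int where m: "m \<noteq> 0" "x [^] m \<in> Z"
      using power_mem_finite_index[OF sZ finZ x(1)] by blast
    then obtain k :: int where k: "x [^] m = z [^] k" by (auto simp: Z_def powers_def)
    have "m * \<phi> x = k * \<phi> z" using arg_cong[OF k, of \<phi>] x z by (simp add: \<phi>.hom_int_pow)
    then have "k = 0" using x \<phi>z by simp
    then show False using k m int_pow_inject[OF infx x(1), of m 0] by simp
  qed
  then have "inj_on \<phi> (carrier G)" using \<phi>.inj_on_one_iff by simp
  then show ?thesis using cyclic_if_embeds_in_integers h by blast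
qed

end

section \<open>Topological transitivity for virtually cyclic groups\<close>

context group
begin

lemma finite_subgroup_infinite_index:
  assumes "infinite (carrier G)" "subgroup H G" "finite H"
  shows "H \<in> infinite_index_subgroups G"
proof -
  have "\<not> finitely_covers G H (carrier G)"
    unfolding finitely_covers_def using assms by (meson finite_set_mult finite_subset)
  then show ?thesis using assms by (simp add: infinite_index_subgroups_def finite_rcosets_iff)
qed

lemma powers_infinite_index_iff:
  "x \<in> carrier G \<Longrightarrow> powers x \<in> infinite_index_subgroups G \<longleftrightarrow> infinite (rcosets (powers x))"
  by (simp add: infinite_index_subgroups_def powers_subgroup)

lemma finite_index_supergroup:
  assumes "subgroup H G" "subgroup K G" "H \<subseteq> K" "finite (rcosets H)"
  shows "finite (rcosets K)"
proof -
  have "H <#> F \<subseteq> K <#> F" for F using assms(3) by (rule mono_set_mult) simp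
  then show ?thesis
    using assms unfolding finite_rcosets_iff[OF assms(1)] finite_rcosets_iff[OF assms(2)]
      finitely_covers_def by (meson subset_trans)
qed

text \<open>If \<open>c\<close> generates a subgroup of infinite index, the open set of subgroups containing \<open>c\<close> is nonempty;
  so is the set of subgroups avoiding all conjugates of \<open>c\<close>, as it contains the trivial subgroup, and
  it is open because there are finitely many conjugates. No conjugate of a member of the first set
  belongs to the second.\<close>

lemma transitive_finite_conjugacy_class:
  assumes tt: "topologically_transitive G (infinite_index_topology G) (conjugation_action G)"
    and inf: "infinite (carrier G)" and c: "c \<in> carrier G" "c \<noteq> \<one>"
    and fin: "finite ((\<lambda>g. g \<otimes> c \<otimes> inv g) ` carrier G)"
  shows "finite (rcosets (powers c))"
proof (rule ccontr)
  let ?X = "infinite_index_topology G"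
  let ?E = "infinite_index_subgroups G"
  let ?cl = "(\<lambda>g. g \<otimes> c \<otimes> inv g) ` carrier G"
  assume "infinite (rcosets (powers c))"
  then have "powers c \<in> {H \<in> ?E. c \<in> H}"
    using c powers_infinite_index_iff powers_self by blast
  then have U: "{H \<in> ?E. c \<in> H} \<noteq> {}" by blast
  define V where "V = (\<Inter>y\<in>?cl. {H \<in> ?E. y \<notin> H})"
  have "openin ?X V"
    unfolding V_def using fin c one_closed
    by (intro openin_INT2) (auto intro!: openin_infinite_index_mem)
  moreover have "{\<one>} \<in> V"
  proof -
    have "g \<otimes> c \<otimes> inv g \<noteq> \<one>" if "g \<in> carrier G" for g
      using inv_conjugate_conjugate[OF that c(1)] c that by auto
    then show ?thesis
      using finite_subgroup_infinite_index[OF inf triv_subgroup] by (auto simp: V_def)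
  qed
  ultimately obtain g H where g: "g \<in> carrier G" "H \<in> ?E" "c \<in> H" "g <# H #> inv g \<in> V"
    using transitive_obtain[OF tt openin_infinite_index_mem(1)[OF c(1)] _ U] by blast
  have "g \<otimes> c \<otimes> inv g \<in> g <# H #> inv g"
    using g by (auto simp: l_coset_def r_coset_def)
  then show False using g by (auto simp: V_def)
qed

lemma involution_infinite_index:
  assumes "infinite (carrier G)" "s \<in> carrier G" "s \<otimes> s = \<one>"
  shows "\<exists>H\<in>infinite_index_subgroups G. s \<in> H"
proof
  have "inv s = s" using assms by (simp add: inv_equality)
  then have "subgroup {\<one>, s} G"
    using assms by (intro subgroupI) auto
  then show "{\<one>, s} \<in> infinite_index_subgroups G"
    using assms finite_subgroup_infinite_index by simp
qed simp

text \<open>Conjugation by \<open>g\<close> and by its inverse raise \<open>z\<close> to integer powers whose exponents have product \<open>1\<close>.\<close>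

lemma normal_infinite_cyclic_conjugation:
  assumes z: "z \<in> carrier G" and inf: "infinite (powers z)" and N: "powers z \<lhd> G"
    and g: "g \<in> carrier G"
  shows "g \<otimes> z \<otimes> inv g = z \<or> g \<otimes> z \<otimes> inv g = inv z"
proof -
  have "g \<otimes> z \<otimes> inv g \<in> powers z" "inv g \<otimes> z \<otimes> inv (inv g) \<in> powers z"
    using N g powers_self[OF z] unfolding normal_inv_iff by blast+
  then obtain a b :: int where a: "g \<otimes> z \<otimes> inv g = z [^] a" and b: "inv g \<otimes> z \<otimes> inv (inv g) = z [^] b"
    unfolding powers_def by blast
  have "z [^] (1::int) = inv g \<otimes> (g \<otimes> z \<otimes> inv g) \<otimes> inv (inv g)"
    using g z by (simp add: m_assoc)
  also have "\<dots> = z [^] (b * a)"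
    using a b g z int_pow_conjugate[of "inv g" z a] by (simp add: int_pow_pow)
  finally have "b * a = 1" using int_pow_inject[OF inf z] by metis
  then have "a = 1 \<or> a = - 1" by (metis zmult_eq_1_iff mult.commute)
  then show ?thesis using a z by (auto simp: int_pow_neg)
qed

text \<open>The normal core of the given cyclic subgroup supplies a normal one, generated by \<open>z\<close>. The
  centralizer \<open>C\<close> of \<open>z\<close> is torsion free by \<open>transitive_finite_conjugacy_class\<close> and then infinite
  cyclic by \<open>transfer_cyclic\<close>, with a generator \<open>d\<close>. An element \<open>s\<close> outside \<open>C\<close> inverts \<open>z\<close>, hence \<open>d\<close>,
  and it is an involution because its square is a power of \<open>d\<close> that \<open>s\<close> both fixes and inverts. The
  conjugates of \<open>d s\<close> are the products of odd powers of \<open>d\<close> with \<open>s\<close>, so the reflections \<open>s\<close> and \<open>d s\<close>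
  cannot be conjugated into a common subgroup of infinite index.\<close>

theorem transitive_virtually_cyclic:
  assumes tt: "topologically_transitive G (infinite_index_topology G) (conjugation_action G)"
    and infG: "infinite (carrier G)" and f: "f \<in> carrier G" and fin: "finite (rcosets (powers f))"
  shows "\<exists>d\<in>carrier G. carrier G = powers d"
proof -
  have sf: "subgroup (powers f) G" using f powers_subgroup by blast
  have N: "normal_core (powers f) \<lhd> G" using normal_core_normal[OF sf] .
  then obtain z where z: "z \<in> normal_core (powers f)" "normal_core (powers f) = powers z"
    using subgroup_of_powers_principal[OF normal_imp_subgroup[OF N] f normal_core_subset[OF sf]] by blast
  then have zc: "z \<in> carrier G" by (simp add: normal_core_def)
  have sz: "subgroup (powers z) G" using zc powers_subgroup by blast
  have Nz: "powers z \<lhd> G" using N z by simp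
  have finz: "finite (rcosets (powers z))"
    using normal_core_finite_index[OF sf fin] z finite_rcosets_iff[OF sz] by simp
  then obtain F where F: "finite F" "F \<subseteq> carrier G" "carrier G \<subseteq> powers z <#> F"
    using finite_rcosets_iff[OF sz] by (auto simp: finitely_covers_def)
  have infz: "infinite (powers z)"
    using F infG by (meson finite_set_mult finite_subset)
  note inv_z = normal_infinite_cyclic_conjugation[OF zc infz Nz]
  define C where "C = {x \<in> carrier G. x \<otimes> z \<otimes> inv x = z}"
  have conj_comp: "(x \<otimes> y) \<otimes> w \<otimes> inv (x \<otimes> y) = x \<otimes> (y \<otimes> w \<otimes> inv y) \<otimes> inv x"
    if "x \<in> carrier G" "y \<in> carrier G" "w \<in> carrier G" for x y w
    using that by (simp add: m_assoc inv_mult_group)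
  have C_iff: "x \<in> C \<longleftrightarrow> x \<otimes> z = z \<otimes> x" if "x \<in> carrier G" for x
    using that zc by (auto simp: C_def inv_solve_right')
  have sC: "subgroup C G"
  proof (rule subgroupI)
    show "C \<subseteq> carrier G" by (auto simp: C_def)
    show "C \<noteq> {}" using zc by (auto simp: C_def)
    show "inv a \<in> C" if "a \<in> C" for a
      using that zc inv_conjugate_conjugate[of a z] by (auto simp: C_def)
    show "a \<otimes> b \<in> C" if "a \<in> C" "b \<in> C" for a b
      using that zc by (auto simp: C_def conj_comp)
  qed
  have Cc: "C \<subseteq> carrier G" by (auto simp: C_def)
  have zC: "z \<in> C" using zc by (simp add: C_iff)
  have PC: "powers z \<subseteq> C" using powers_subset_subgroup[OF sC zC] .
  \<comment> \<open>the centralizer of an element of \<open>C\<close> contains the powers of \<open>z\<close>, hence has finite index\<close>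
  have finC: "finite (rcosets (powers c))" if c: "c \<in> C" "c \<noteq> \<one>" for c
  proof -
    have cc: "c \<in> carrier G" using c Cc by blast
    have "(\<lambda>g. g \<otimes> c \<otimes> inv g) ` carrier G \<subseteq> (\<lambda>e. inv e \<otimes> c \<otimes> e) ` F"
    proof clarify
      fix g assume g: "g \<in> carrier G"
      then have "inv g \<in> powers z <#> F" using F by blast
      then obtain n :: int and e where e: "e \<in> F" "inv g = z [^] n \<otimes> e"
        unfolding set_mult_iff powers_def by blast
      have ec: "e \<in> carrier G" using e F by blast
      have "c \<otimes> z \<otimes> inv c = z" using c by (simp add: C_def)
      then have "c \<otimes> z [^] n \<otimes> inv c = z [^] n" using int_pow_conjugate[OF cc zc] by simp
      then have comm: "c \<otimes> z [^] n = z [^] n \<otimes> c"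
        using cc zc by (simp add: inv_solve_right')
      have "g = inv e \<otimes> inv (z [^] n)"
        using e ec zc g by (metis inv_inv inv_mult_group int_pow_closed)
      then have "g \<otimes> c \<otimes> inv g = inv e \<otimes> (inv (z [^] n) \<otimes> (c \<otimes> z [^] n)) \<otimes> e"
        using e ec zc cc by (simp add: m_assoc)
      also have "\<dots> = inv e \<otimes> c \<otimes> e" using comm ec zc cc by simp
      finally show "g \<otimes> c \<otimes> inv g \<in> (\<lambda>e. inv e \<otimes> c \<otimes> e) ` F" using e by blast
    qed
    then have "finite ((\<lambda>g. g \<otimes> c \<otimes> inv g) ` carrier G)"
      using F(1) finite_surj by blast
    then show ?thesis using transitive_finite_conjugacy_class[OF tt infG cc c(2)] by blast
  qed
  have infC: "infinite (powers c)" if "c \<in> C" "c \<noteq> \<one>" for c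
  proof
    assume "finite (powers c)"
    then have "powers c \<in> infinite_index_subgroups G"
      using finite_subgroup_infinite_index[OF infG powers_subgroup] that Cc by blast
    then show False using finC[OF that] by (simp add: infinite_index_subgroups_def)
  qed
  interpret GC: group "G\<lparr>carrier := C\<rparr>" using sC subgroup_imp_group by blast
  have pC: "GC.powers x = powers x" if "x \<in> C" for x
    unfolding GC.powers_def powers_def using int_pow_consistent[OF sC that] by simp
  have "finite (rcosets\<^bsub>G\<lparr>carrier := C\<rparr>\<^esub> (powers z))"
    using finz by (rule finite_subset[rotated]) (use Cc in \<open>auto simp: RCOSETS_def\<close>)
  moreover have "z \<noteq> \<one>" using infz finite_powers[of \<one> 1] by auto
  ultimately have "\<exists>d\<in>carrier (G\<lparr>carrier := C\<rparr>). carrier (G\<lparr>carrier := C\<rparr>) = GC.powers d"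
    using zC C_iff Cc infC by (intro GC.transfer_cyclic[of z]) (auto simp: pC)
  then obtain d where d: "d \<in> C" "C = powers d" using pC by auto
  have dc: "d \<in> carrier G" using d Cc by blast
  have infd: "infinite (powers d)" using PC d infz infinite_super by blast
  obtain k :: int where k: "z = d [^] k" using zC d unfolding powers_def by blast
  have k0: "k \<noteq> 0" using k infz finite_powers[of \<one> 1] by auto
  show ?thesis
  proof (cases "C = carrier G")
    case True
    then show ?thesis using d by blast
  next
    case False
    then obtain s where s: "s \<in> carrier G" "s \<notin> C" using Cc by blast
    have invert_z: "x \<otimes> z \<otimes> inv x = inv z" if "x \<in> carrier G" "x \<notin> C" for x
      using inv_z[OF that(1)] that by (auto simp: C_def)
    have mult_C: "x \<otimes> y \<in> C" if "x \<in> carrier G" "x \<notin> C" "y \<in> carrier G" "y \<notin> C" for x y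
    proof -
      have "(x \<otimes> y) \<otimes> z \<otimes> inv (x \<otimes> y) = x \<otimes> (y \<otimes> z \<otimes> inv y) \<otimes> inv x"
        using conj_comp that zc by blast
      also have "\<dots> = inv (x \<otimes> z \<otimes> inv x)"
        by (simp only: invert_z[OF that(3,4)] conjugate_inv[OF that(1) zc])
      also have "\<dots> = z" using invert_z[OF that(1,2)] zc by simp
      finally show ?thesis using that by (simp add: C_def)
    qed
    have invert: "x \<otimes> d [^] i \<otimes> inv x = d [^] (- i)" if x: "x \<in> carrier G" "x \<notin> C" for x and i :: int
    proof -
      have "x \<otimes> d \<otimes> inv x \<in> C"
      proof (rule ccontr)
        assume "x \<otimes> d \<otimes> inv x \<notin> C"
        then have "(x \<otimes> d \<otimes> inv x) \<otimes> x \<in> C" using mult_C x dc by simp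
        then have "x \<otimes> d \<in> C" using x dc by (simp add: m_assoc)
        then have "(x \<otimes> d) \<otimes> inv d \<in> C" using d sC subgroup.m_closed subgroup.m_inv_closed by metis
        then show False using x dc by (simp add: m_assoc)
      qed
      then obtain j :: int where j: "x \<otimes> d \<otimes> inv x = d [^] j" using d unfolding powers_def by blast
      have "d [^] (- k) = x \<otimes> d [^] k \<otimes> inv x"
        using invert_z[OF x] k dc by (simp add: int_pow_neg)
      also have "\<dots> = d [^] (j * k)" using int_pow_conjugate[OF x(1) dc] j dc by (simp add: int_pow_pow)
      finally have "- k = j * k" using int_pow_inject[OF infd dc] by blast
      then have "(j + 1) * k = 0" by (simp add: algebra_simps)
      then have "j = - 1" using k0 by simp
      then show ?thesis using int_pow_conjugate[OF x(1) dc] j dc by (simp add: int_pow_pow)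
    qed
    have square: "x \<otimes> x = \<one>" if x: "x \<in> carrier G" "x \<notin> C" for x
    proof -
      obtain i :: int where i: "x \<otimes> x = d [^] i" using mult_C[OF x x] d unfolding powers_def by blast
      have "d [^] (- i) = x \<otimes> (x \<otimes> x) \<otimes> inv x" using invert[OF x, of i] i by simp
      also have "\<dots> = x \<otimes> x" using x by (simp add: m_assoc)
      also have "\<dots> = d [^] i" using i .
      finally have "- i = i" using int_pow_inject[OF infd dc] by blast
      then show ?thesis using i by simp
    qed
    have ds: "d \<otimes> s \<in> carrier G" "d \<otimes> s \<notin> C"
    proof -
      show "d \<otimes> s \<in> carrier G" using dc s by simp
      show "d \<otimes> s \<notin> C"
      proof
        assume "d \<otimes> s \<in> C"
        then have "inv d \<otimes> (d \<otimes> s) \<in> C" using d sC subgroup.m_closed subgroup.m_inv_closed by metis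
        then show False using s dc by simp
      qed
    qed
    obtain g H where g: "g \<in> carrier G" and H: "H \<in> infinite_index_subgroups G" "s \<in> H"
      and gH: "d \<otimes> s \<in> g <# H #> inv g"
    proof (rule transitive_obtain[OF tt openin_infinite_index_mem(1)[OF s(1)]
          openin_infinite_index_mem(1)[OF ds(1)]])
      show "{H \<in> infinite_index_subgroups G. s \<in> H} \<noteq> {}"
        using involution_infinite_index[OF infG s(1) square[OF s]] by blast
      show "{H \<in> infinite_index_subgroups G. d \<otimes> s \<in> H} \<noteq> {}"
        using involution_infinite_index[OF infG ds(1) square[OF ds]] by blast
    qed (use that in blast)
    have sH: "subgroup H G" using H by (simp add: infinite_index_subgroups_def)
    \<comment> \<open>the product of two reflections of \<open>H\<close>, one of each class, is a rotation by an odd power of \<open>d\<close>\<close>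
    define y where "y = inv g \<otimes> (d \<otimes> s) \<otimes> g \<otimes> s"
    have "y \<in> H"
      using gH H conjugate_mem_iff[OF g subgroup.subset[OF sH] ds(1)] subgroup.m_closed[OF sH]
      by (simp add: y_def)
    have sds: "s \<otimes> d [^] i = d [^] (- i) \<otimes> s" for i :: int
      using invert[OF s, of i] s dc by (metis inv_solve_right' int_pow_closed m_closed)
    have "\<exists>m::int. odd m \<and> y = d [^] m"
    proof (cases "g \<in> C")
      case True
      then obtain i :: int where i: "g = d [^] i" using d unfolding powers_def by blast
      have "y = d [^] (- i) \<otimes> (d [^] (1::int) \<otimes> (s \<otimes> d [^] i) \<otimes> s)"
        using i s dc by (simp add: y_def m_assoc int_pow_neg)
      also have "\<dots> = d [^] (- i) \<otimes> (d [^] (1::int) \<otimes> d [^] (- i)) \<otimes> (s \<otimes> s)"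
        using s dc unfolding sds by (simp add: m_assoc)
      also have "\<dots> = d [^] (- i + (1 + - i))"
        using s dc square[OF s] by (simp only: int_pow_mult int_pow_closed r_one m_closed)
      finally show ?thesis by (intro exI[of _ "- i + (1 + - i)"]) simp
    next
      case False
      then obtain i :: int where i: "g \<otimes> s = d [^] i"
        using mult_C[OF g False s] d unfolding powers_def by blast
      have inv_s: "inv s = s" using square[OF s] s by (simp add: inv_equality)
      have gi: "g = d [^] i \<otimes> s"
        using i g s inv_s by (metis inv_solve_right int_pow_closed dc)
      have "y = s \<otimes> (d [^] (- i) \<otimes> d [^] (1::int)) \<otimes> (s \<otimes> d [^] i) \<otimes> (s \<otimes> s)"
        using gi inv_s s dc by (simp add: y_def m_assoc int_pow_neg inv_mult_group)
      also have "\<dots> = (s \<otimes> d [^] (- i + 1)) \<otimes> (s \<otimes> d [^] i)"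
        using s dc square[OF s] by (simp only: int_pow_mult int_pow_closed m_closed r_one)
      also have "\<dots> = d [^] (- (- i + 1)) \<otimes> (s \<otimes> s) \<otimes> d [^] i"
        using s dc unfolding sds[of "- i + 1"] by (simp add: m_assoc)
      also have "\<dots> = d [^] (- (- i + 1) + i)"
        using s dc square[OF s] by (simp only: int_pow_mult int_pow_closed r_one)
      finally show ?thesis by (intro exI[of _ "- (- i + 1) + i"]) simp
    qed
    then obtain m :: int where m: "odd m" "y = d [^] m" by blast
    have "y \<noteq> \<one>"
    proof
      assume "y = \<one>"
      then have "m = 0" using m int_pow_inject[OF infd dc, of m 0] by simp
      then show False using m by simp
    qed
    moreover have "y \<in> C" using m d by (auto simp: powers_def)
    ultimately have "finite (rcosets (powers y))" using finC by blast
    then have "finite (rcosets H)"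
      using finite_index_supergroup[OF powers_subgroup sH powers_subset_subgroup[OF sH \<open>y \<in> H\<close>]]
        \<open>y \<in> C\<close> Cc by blast
    then show ?thesis using H by (simp add: infinite_index_subgroups_def)
  qed
qed

section \<open>The infinite cyclic group\<close>

lemma infinite_cyclic_iso_integers:
  assumes d: "d \<in> carrier G" "carrier G = powers d" and inf: "infinite (carrier G)"
  shows "G \<cong> integer_group"
proof -
  have "inj (\<lambda>n::int. d [^] n)"
    using int_pow_inject[of d] assms by (intro injI) auto
  then have "(\<lambda>n::int. d [^] n) \<in> iso integer_group G"
    using hom_integer_group_pow[OF d(1)] d(2) unfolding powers_def by (simp add: iso_def bij_betw_def)
  then show ?thesis
    using group.iso_sym[OF group_integer_group] is_isoI by blast
qed

lemma cyclic_infinite_index_trivial: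
  assumes d: "d \<in> carrier G" "carrier G = powers d"
  shows "infinite_index_subgroups G \<subseteq> {{\<one>}}"
proof
  fix H assume H: "H \<in> infinite_index_subgroups G"
  then have sH: "subgroup H G" by (simp add: infinite_index_subgroups_def)
  have "x = \<one>" if x: "x \<in> H" for x
  proof (rule ccontr)
    assume "x \<noteq> \<one>"
    obtain k :: int where k: "x = d [^] k"
      using subgroup.mem_carrier[OF sH x] d unfolding powers_def by blast
    then have "k \<noteq> 0" using \<open>x \<noteq> \<one>\<close> by auto
    define F where "F = (\<lambda>n::int. d [^] n) ` {- \<bar>k\<bar>..\<bar>k\<bar>}"
    have F: "finite F" "F \<subseteq> carrier G"
      using int_pow_closed[OF d(1)] unfolding F_def by blast+
    have "carrier G \<subseteq> H <#> F"
    proof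
      fix g assume "g \<in> carrier G"
      then obtain n :: int where n: "g = d [^] n" using d unfolding powers_def by blast
      have "g = d [^] (k * (n div k) + n mod k)" using n by simp
      also have "\<dots> = x [^] (n div k) \<otimes> d [^] (n mod k)"
        using d k by (simp only: int_pow_mult int_pow_pow)
      finally have "g = x [^] (n div k) \<otimes> d [^] (n mod k)" .
      moreover have "d [^] (n mod k) \<in> F"
        unfolding F_def using abs_mod_less[OF \<open>k \<noteq> 0\<close>, of n]
        by (intro imageI) (auto simp: abs_le_iff)
      ultimately show "g \<in> H <#> F"
        unfolding set_mult_iff using subgroup_int_pow_closed[OF sH x] by blast
    qed
    with F have "finitely_covers G H (carrier G)"
      unfolding finitely_covers_def by (intro exI[of _ F] conjI)
    then show False using H finite_rcosets_iff[OF sH] by (simp add: infinite_index_subgroups_def)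
  qed
  then show "H \<in> {{\<one>}}" using subgroup.one_closed[OF sH] by blast
qed

end

theorem corollary3p14:
  fixes G :: "('a, 'b) monoid_scheme"
  assumes "group G"
    and "countable (carrier G)"
    and "infinite (carrier G)"
    and "virtually_solvable G"
  shows "topologically_transitive G (infinite_index_topology G) (conjugation_action G)
    \<longleftrightarrow> G \<cong> integer_group"
proof
  interpret group G by fact
  assume tt: "topologically_transitive G (infinite_index_topology G) (conjugation_action G)"
  have "\<exists>f\<in>carrier G. finite (rcosets\<^bsub>G\<^esub> (powers f))"
  proof (rule ccontr)
    assume "\<not> ?thesis"
    then have "\<exists>K\<in>infinite_index_subgroups G. t \<in> K" if "t \<in> carrier G" for t
      using that powers_infinite_index_iff powers_self by blast
    then obtain H where H: "H \<in> infinite_index_subgroups G"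
      "\<forall>t\<in>carrier G. \<exists>x\<in>carrier G. x \<otimes>\<^bsub>G\<^esub> t \<otimes>\<^bsub>G\<^esub> inv\<^bsub>G\<^esub> x \<in> H"
      using transitive_imp_conjugate_dense[OF tt assms(2)] by blast
    then have "finite (rcosets\<^bsub>G\<^esub> H)"
      using virtually_solvable_conjugate_dense[OF assms(4), of H] by (simp add: infinite_index_subgroups_def)
    then show False using H by (simp add: infinite_index_subgroups_def)
  qed
  then show "G \<cong> integer_group"
    using transitive_virtually_cyclic[OF tt assms(3)] infinite_cyclic_iso_integers assms(3) by blast
next
  interpret group G by fact
  assume "G \<cong> integer_group"
  then have "cyclic_group G"
    using isomorphic_group_cyclicity is_group group_integer_group cyclic_integer_group by blast
  then obtain d where "d \<in> carrier G" "carrier G = powers d"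
    unfolding cyclic_group powers_def by blast
  then have sub: "infinite_index_subgroups G \<subseteq> {{\<one>\<^bsub>G\<^esub>}}" using cyclic_infinite_index_trivial by blast
  show "topologically_transitive G (infinite_index_topology G) (conjugation_action G)"
    unfolding topologically_transitive_def
  proof (intro allI impI, elim conjE)
    fix U V assume U: "openin (infinite_index_topology G) U" "U \<noteq> {}"
      and V: "openin (infinite_index_topology G) V" "V \<noteq> {}"
    have "U \<subseteq> infinite_index_subgroups G" "V \<subseteq> infinite_index_subgroups G"
      using U V openin_subset topspace_infinite_index_topology by blast+
    then have UV: "{\<one>\<^bsub>G\<^esub>} \<in> infinite_index_subgroups G" "U = {{\<one>\<^bsub>G\<^esub>}}" "V = {{\<one>\<^bsub>G\<^esub>}}"
      using U V sub by blast+
    have "conjugation_action G \<one>\<^bsub>G\<^esub> {\<one>\<^bsub>G\<^esub>} = {\<one>\<^bsub>G\<^esub>}"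
      using UV by (simp add: conjugation_action_def l_coset_def r_coset_def)
    then show "\<exists>g\<in>carrier G. conjugation_action G g ` U \<inter> V \<noteq> {}"
      using UV by (intro bexI[of _ "\<one>\<^bsub>G\<^esub>"]) auto
  qed
qed

end
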